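(* Let $\Gamma$ be any nontrivial additive subgroup of $\mathbb{C}$ and let $W=W(\Gamma)$ be the complex Lie algebra with basis $\{L_{\alpha,i}\mid \alpha\in\Gamma,\ i\in\mathbb{Z}_+\}$ and bracket $$[L_{\alpha,i},L_{\beta,j}]=(\beta-\alpha)L_{\alpha+\beta,i+j}+(j-i)L_{\alpha+\beta,i+j+1}\qquad(\alpha,\beta\in\Gamma,\ i,j\in\mathbb{Z}_+).$$ Let $\chi(\Gamma)$ be the set of group homomorphisms $\tau:\Gamma\to\mathbb{C}^*$, let $\Gamma^{\mathbb{C}^*}=\{c\in\mathbb{C}^*\mid c\Gamma=\Gamma\}$, and let $\chi(\Gamma)\rtimes\Gamma^{\mathbb{C}^*}$ be the set $\chi(\Gamma)\times\Gamma^{\mathbb{C}^*}$ with the group structure $$(\tau_1,c_1)\cdot(\tau_2,c_2)=(\tau,c_1c_2),\qquad \tau(\alpha)=\tau_1(c_2\alpha)\tau_2(\alpha)\quad(\alpha\in\Gamma).$$ For $(\tau,c)\in\chi(\Gamma)\times\Gamma^{\mathbb{C}^*}$ let $\phi_{\tau,c}$ be the automorphism of $W$ given by $$\phi_{\tau,c}(L_{\alpha,i})=\tau(\alpha)c^{-i-1}L_{c\alpha,i}\qquad(\alpha\in\Gamma,\ i\in\mathbb{Z}_+).$$ Then the map $\phi:(\tau,c)\mapsto\phi_{\tau,c}$ is a group isomorphism from $\chi(\Gamma)\rtimes\Gamma^{\mathbb{C}^*}$ onto $\mathrm{Aut}\,W$; that is, $\mathrm{Aut}\,W\cong\chi(\Gamma)\rtimes\Gamma^{\mathbb{C}^*}$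 via $\phi$.
   Context: $\mathbb{Z}_+$ denotes the set of nonnegative integers and $\mathbb{C}^*$ the (multiplicative group of) nonzero complex numbers. "Nontrivial" means $\Gamma\neq\{0\}$. $\mathrm{Aut}\,W$ is the group (under composition) of ($\mathbb{C}$-linear) Lie algebra automorphisms of $W$. *)

theory Defs
  imports Complex_Main "HOL-Algebra.Bij" "HOL-Library.Poly_Mapping"
begin

definition complex_add :: "complex monoid" where
  "complex_add = \<lparr>carrier = UNIV, mult = (+), one = 0\<rparr>"

definition complex_units :: "complex monoid" where
  "complex_units = \<lparr>carrier = UNIV - {0}, mult = (*), one = 1\<rparr>"


text \<open>
  The element \<open>L \<alpha> i\<close> is the basis vector with index \<open>(\<alpha>, i)\<close>. The operations are defined on
  all finitely supported functions on \<open>complex \<times> nat\<close>; \<open>W(\<Gamma>)\<close> is the subspace \<open>W \<Gamma>\<close> of those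
  supported on \<open>\<Gamma> \<times> UNIV\<close>.
\<close>

type_synonym vec = "(complex \<times> nat) \<Rightarrow>\<^sub>0 complex"

definition scale :: "complex \<Rightarrow> vec \<Rightarrow> vec" where
  "scale c x = Poly_Mapping.map ((*) c) x"

definition L :: "complex \<Rightarrow> nat \<Rightarrow> vec" where
  "L \<alpha> i = Poly_Mapping.single (\<alpha>, i) 1"

definition W :: "complex set \<Rightarrow> vec set" where
  "W \<Gamma> = {x. Poly_Mapping.keys x \<subseteq> \<Gamma> \<times> UNIV}"

definition lin_ext :: "(complex \<Rightarrow> nat \<Rightarrow> vec) \<Rightarrow> vec \<Rightarrow> vec" where
  "lin_ext f x = (\<Sum>(\<alpha>, i)\<in>Poly_Mapping.keys x. scale (Poly_Mapping.lookup x (\<alpha>, i)) (f \<alpha> i))"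

definition bracket :: "vec \<Rightarrow> vec \<Rightarrow> vec" where
  "bracket x y =
     lin_ext (\<lambda>\<alpha> i. lin_ext (\<lambda>\<beta> j.
       scale (\<beta> - \<alpha>) (L (\<alpha> + \<beta>) (i + j)) +
       scale (of_nat j - of_nat i) (L (\<alpha> + \<beta>) (i + j + 1))) y) x"


text \<open>
  As in \<^const>\<open>BijGroup\<close>, maps with a restricted domain are represented by extensional functions,
  so that equality of functions is equality on the domain.
\<close>

definition lie_auto :: "complex set \<Rightarrow> (vec \<Rightarrow> vec) set" where
  "lie_auto \<Gamma> = {f \<in> Bij (W \<Gamma>).
     (\<forall>x\<in>W \<Gamma>. \<forall>y\<in>W \<Gamma>. f (x + y) = f x + f y) \<and>
     (\<forall>c. \<forall>x\<in>W \<Gamma>. f (scale c x) = scale c (f x)) \<and>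
     (\<forall>x\<in>W \<Gamma>. \<forall>y\<in>W \<Gamma>. f (bracket x y) = bracket (f x) (f y))}"

definition LieAutoGroup :: "complex set \<Rightarrow> (vec \<Rightarrow> vec) monoid" where
  "LieAutoGroup \<Gamma> = BijGroup (W \<Gamma>) \<lparr>carrier := lie_auto \<Gamma>\<rparr>"

definition characters :: "complex set \<Rightarrow> (complex \<Rightarrow> complex) set" where
  "characters \<Gamma> = hom (complex_add\<lparr>carrier := \<Gamma>\<rparr>) complex_units \<inter> extensional \<Gamma>"

definition scalings :: "complex set \<Rightarrow> complex set" where
  "scalings \<Gamma> = {c. c \<noteq> 0 \<and> (*) c ` \<Gamma> = \<Gamma>}"

definition semidirect :: "complex set \<Rightarrow> ((complex \<Rightarrow> complex) \<times> complex) monoid" where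
  "semidirect \<Gamma> =
     \<lparr>carrier = characters \<Gamma> \<times> scalings \<Gamma>,
      mult = (\<lambda>(\<tau>\<^sub>1, c\<^sub>1) (\<tau>\<^sub>2, c\<^sub>2). (\<lambda>\<alpha>\<in>\<Gamma>. \<tau>\<^sub>1 (c\<^sub>2 * \<alpha>) * \<tau>\<^sub>2 \<alpha>, c\<^sub>1 * c\<^sub>2)),
      one = (\<lambda>\<alpha>\<in>\<Gamma>. 1, 1)\<rparr>"

definition phi :: "complex set \<Rightarrow> (complex \<Rightarrow> complex) \<times> complex \<Rightarrow> vec \<Rightarrow> vec" where
  "phi \<Gamma> = (\<lambda>(\<tau>, c). \<lambda>x\<in>W \<Gamma>.
     lin_ext (\<lambda>\<alpha> i. scale (\<tau> \<alpha> * c powi (- int i - 1)) (L (c * \<alpha>) i)) x)"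


text \<open>Sanity checks: the prescribed values on the basis, and the Lie algebra axioms.\<close>

lemma lookup_scale [simp]: "Poly_Mapping.lookup (scale c x) k = c * Poly_Mapping.lookup x k"
  unfolding scale_def by (simp add: Poly_Mapping.map.rep_eq when_def)

lemma scale_simps:
  "scale c (x + y) = scale c x + scale c y"
  "scale (a + b) x = scale a x + scale b x"
  "scale a (scale b x) = scale (a * b) x"
  "scale c 0 = 0" "scale 0 x = 0" "scale 1 x = x"
  by (rule poly_mapping_eqI; simp add: lookup_add algebra_simps)+

lemma scale_sum: "scale c (sum f A) = (\<Sum>a\<in>A. scale c (f a))"
  by (induction A rule: infinite_finite_induct) (simp_all add: scale_simps)

lemma lin_ext_superset:
  assumes "finite S" "Poly_Mapping.keys x \<subseteq> S"
  shows "lin_ext f x = (\<Sum>(\<alpha>, i)\<in>S. scale (Poly_Mapping.lookup x (\<alpha>, i)) (f \<alpha> i))"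
  unfolding lin_ext_def using assms
  by (intro sum.mono_neutral_left) (auto simp: scale_simps in_keys_iff)

lemma lin_ext_add: "lin_ext f (x + y) = lin_ext f x + lin_ext f y"
proof -
  let ?S = "Poly_Mapping.keys x \<union> Poly_Mapping.keys y"
  have "Poly_Mapping.keys (x + y) \<subseteq> ?S" by (rule keys_add)
  then show ?thesis
    by (simp add: lin_ext_superset[of ?S] lookup_add scale_simps split_def flip: sum.distrib)
qed

lemma lin_ext_scale: "lin_ext f (scale c x) = scale c (lin_ext f x)"
proof -
  have "Poly_Mapping.keys (scale c x) \<subseteq> Poly_Mapping.keys x" by (auto simp: in_keys_iff)
  then show ?thesis
    by (simp add: lin_ext_superset[of "Poly_Mapping.keys x"] scale_sum scale_simps split_def)
qed

lemma lin_ext_L [simp]: "lin_ext f (L \<alpha> i) = f \<alpha> i"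
  by (simp add: lin_ext_def L_def scale_simps)

lemma lin_ext_fun_add: "lin_ext (\<lambda>\<alpha> i. f \<alpha> i + g \<alpha> i) x = lin_ext f x + lin_ext g x"
  by (simp add: lin_ext_def scale_simps split_def sum.distrib)

lemma lin_ext_fun_scale: "lin_ext (\<lambda>\<alpha> i. scale c (f \<alpha> i)) x = scale c (lin_ext f x)"
  by (simp add: lin_ext_def scale_simps split_def scale_sum mult.commute)

lemma bracket_L:
  "bracket (L \<alpha> i) (L \<beta> j) =
     scale (\<beta> - \<alpha>) (L (\<alpha> + \<beta>) (i + j)) +
     scale (of_nat j - of_nat i) (L (\<alpha> + \<beta>) (i + j + 1))"
  by (simp add: bracket_def)

lemma phi_L:
  "\<alpha> \<in> \<Gamma> \<Longrightarrow> phi \<Gamma> (\<tau>, c) (L \<alpha> i) = scale (\<tau> \<alpha> * c powi (- int i - 1)) (L (c * \<alpha>) i)"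
proof -
  assume "\<alpha> \<in> \<Gamma>"
  then have "L \<alpha> i \<in> W \<Gamma>" by (simp add: W_def L_def)
  then show ?thesis by (simp add: phi_def)
qed

lemma bracket_bilinear:
  "bracket (x + y) z = bracket x z + bracket y z"
  "bracket x (y + z) = bracket x y + bracket x z"
  "bracket (scale c x) y = scale c (bracket x y)"
  "bracket x (scale c y) = scale c (bracket x y)"
  by (simp_all add: bracket_def lin_ext_add lin_ext_scale lin_ext_fun_add lin_ext_fun_scale
        scale_simps(1) add_ac mult.commute)

lemma lin_ext_basis: "lin_ext L x = x"
proof (rule poly_mapping_eqI)
  fix k
  have "Poly_Mapping.lookup (lin_ext L x) k =
      (\<Sum>a\<in>Poly_Mapping.keys x. if k = a then Poly_Mapping.lookup x a else 0)"
    unfolding lin_ext_def split_def lookup_sum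
    by (intro sum.cong) (auto simp: L_def lookup_single when_def)
  also have "\<dots> = Poly_Mapping.lookup x k"
    by (simp add: in_keys_iff)
  finally show "Poly_Mapping.lookup (lin_ext L x) k = Poly_Mapping.lookup x k" .
qed

lemma vec_induct [case_names L scale add]:
  assumes "\<And>\<alpha> i. P (L \<alpha> i)" "\<And>c x. P x \<Longrightarrow> P (scale c x)"
    "\<And>x y. P x \<Longrightarrow> P y \<Longrightarrow> P (x + y)"
  shows "P x"
proof -
  have zero: "P 0" using assms(2)[OF assms(1), of 0] by (simp add: scale_simps)
  have "P (sum g A)" if "\<And>a. P (g a)" for g and A :: "(complex \<times> nat) set"
    by (induction A rule: infinite_finite_induct) (simp_all add: zero that assms(3))
  then have "P (lin_ext L x)"
    unfolding lin_ext_def split_def by (simp add: assms(1,2))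
  then show ?thesis by (simp only: lin_ext_basis)
qed

lemma bracket_antisym: "bracket x y + bracket y x = 0"
proof (induction x rule: vec_induct)
  case (L \<alpha> i)
  show ?case
  proof (induction y rule: vec_induct)
    case (L \<beta> j)
    show ?case
      unfolding bracket_L
      by (rule poly_mapping_eqI) (simp add: lookup_add algebra_simps)
  next
    case (scale c y)
    then show ?case by (simp only: bracket_bilinear scale_simps(4) flip: scale_simps(1))
  next
    case (add y z)
    have "bracket (L \<alpha> i) (y + z) + bracket (y + z) (L \<alpha> i) =
        (bracket (L \<alpha> i) y + bracket y (L \<alpha> i)) +
        (bracket (L \<alpha> i) z + bracket z (L \<alpha> i))"
      by (simp only: bracket_bilinear add_ac)
    then show ?case by (simp only: add add_0)
  qed
next
  case (scale c x)
  then show ?case by (simp only: bracket_bilinear scale_simps(4) flip: scale_simps(1))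
next
  case (add x z)
  have "bracket (x + z) y + bracket y (x + z) =
      (bracket x y + bracket y x) +
      (bracket z y + bracket y z)"
    by (simp only: bracket_bilinear add_ac)
  then show ?case by (simp only: add add_0)
qed

lemma bracket_self: "bracket x x = 0"
proof (rule poly_mapping_eqI)
  fix k
  have "Poly_Mapping.lookup (bracket x x + bracket x x) k = 0"
    by (simp only: bracket_antisym lookup_zero)
  then show "Poly_Mapping.lookup (bracket x x) k = Poly_Mapping.lookup 0 k"
    by (simp add: lookup_add)
qed

lemma bracket_jacobi:
  "bracket x (bracket y z) + bracket y (bracket z x) + bracket z (bracket x y) = 0"
proof (induction x rule: vec_induct)
  case (L \<alpha> i)
  show ?case
  proof (induction y rule: vec_induct)
    case (L \<beta> j)
    show ?case
    proof (induction z rule: vec_induct)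
      case (L \<gamma> k)
      show ?case
        unfolding bracket_L bracket_bilinear
        by (rule poly_mapping_eqI) (simp add: lookup_add algebra_simps)
    next
      case (scale c z)
      then show ?case by (simp only: bracket_bilinear scale_simps(4) flip: scale_simps(1))
    next
      case (add z z')
      have "bracket (L \<alpha> i) (bracket (L \<beta> j) (z + z')) + bracket (L \<beta> j) (bracket (z + z') (L \<alpha> i)) + bracket (z + z') (bracket (L \<alpha> i) (L \<beta> j)) =
          (bracket (L \<alpha> i) (bracket (L \<beta> j) z) + bracket (L \<beta> j) (bracket z (L \<alpha> i)) + bracket z (bracket (L \<alpha> i) (L \<beta> j))) +
          (bracket (L \<alpha> i) (bracket (L \<beta> j) z') + bracket (L \<beta> j) (bracket z' (L \<alpha> i)) + bracket z' (bracket (L \<alpha> i) (L \<beta> j)))"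
        by (simp only: bracket_bilinear add_ac)
      then show ?case by (simp only: add add_0)
    qed
  next
    case (scale c y)
    then show ?case by (simp only: bracket_bilinear scale_simps(4) flip: scale_simps(1))
  next
    case (add y y')
    have "bracket (L \<alpha> i) (bracket (y + y') z) + bracket (y + y') (bracket z (L \<alpha> i)) + bracket z (bracket (L \<alpha> i) (y + y')) =
        (bracket (L \<alpha> i) (bracket y z) + bracket y (bracket z (L \<alpha> i)) + bracket z (bracket (L \<alpha> i) y)) +
        (bracket (L \<alpha> i) (bracket y' z) + bracket y' (bracket z (L \<alpha> i)) + bracket z (bracket (L \<alpha> i) y'))"
      by (simp only: bracket_bilinear add_ac)
    then show ?case by (simp only: add add_0)
  qed
next
  case (scale c x)
  then show ?case by (simp only: bracket_bilinear scale_simps(4) flip: scale_simps(1))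
next
  case (add x x')
  have "bracket (x + x') (bracket y z) + bracket y (bracket z (x + x')) + bracket z (bracket (x + x') y) =
      (bracket x (bracket y z) + bracket y (bracket z x) + bracket z (bracket x y)) +
      (bracket x' (bracket y z) + bracket y (bracket z x') + bracket z (bracket x' y))"
    by (simp only: bracket_bilinear add_ac)
  then show ?case by (simp only: add add_0)
qed

lemma W_closed:
  "0 \<in> W \<Gamma>"
  "x \<in> W \<Gamma> \<Longrightarrow> y \<in> W \<Gamma> \<Longrightarrow> x + y \<in> W \<Gamma>"
  "x \<in> W \<Gamma> \<Longrightarrow> scale c x \<in> W \<Gamma>"
  "\<alpha> \<in> \<Gamma> \<Longrightarrow> L \<alpha> i \<in> W \<Gamma>"
  using keys_add[of x y]
  by (auto simp: W_def L_def in_keys_iff)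

lemma lin_ext_closed:
  assumes "\<And>\<alpha> i. \<alpha> \<in> \<Gamma> \<Longrightarrow> f \<alpha> i \<in> W \<Delta>" "x \<in> W \<Gamma>"
  shows "lin_ext f x \<in> W \<Delta>"
proof -
  have "sum g A \<in> W \<Delta>" if "\<And>a. a \<in> A \<Longrightarrow> g a \<in> W \<Delta>" for g and A :: "(complex \<times> nat) set"
    using that by (induction A rule: infinite_finite_induct) (auto intro: W_closed)
  moreover have "fst a \<in> \<Gamma>" if "a \<in> Poly_Mapping.keys x" for a
    using that assms(2) by (auto simp: W_def)
  ultimately show ?thesis
    unfolding lin_ext_def split_def using assms(1) by (simp add: W_closed)
qed

lemma bracket_closed:
  assumes "subgroup \<Gamma> complex_add" "x \<in> W \<Gamma>" "y \<in> W \<Gamma>"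
  shows "bracket x y \<in> W \<Gamma>"
proof -
  have "\<alpha> + \<beta> \<in> \<Gamma>" if "\<alpha> \<in> \<Gamma>" "\<beta> \<in> \<Gamma>" for \<alpha> \<beta>
    using subgroup.m_closed[OF assms(1) that] by (simp add: complex_add_def)
  with assms(2,3) show ?thesis
    unfolding bracket_def by (intro lin_ext_closed[of \<Gamma>] W_closed) auto
qed

end

theory Submission
  imports Defs "HOL-Library.Product_Plus"
begin

text \<open>
  Identify \<open>L \<alpha> i\<close> with the vector field \<open>x\<^sup>\<alpha> t\<^sup>i \<partial>\<close> over the domain \<open>A = \<complex>[\<Gamma>][t]\<close>, where
  \<open>\<partial> x\<^sup>\<alpha> = \<alpha> x\<^sup>\<alpha>\<close> and \<open>\<partial> t = t\<^sup>2\<close>; then \<open>[f \<partial>, g \<partial>] = (f \<partial>g - g \<partial>f) \<partial>\<close>. If \<open>y\<^sub>\<alpha>\<close> is the image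
  of \<open>L \<alpha> 0\<close> under an automorphism, the bracket relations yield \<open>y\<^sub>\<alpha> y\<^sub>\<beta> = y\<^sub>0 y\<^bsub>\<alpha>+\<beta>\<^esub>\<close> in \<open>A\<close>. All integer
  powers of \<open>y\<^sub>\<alpha> / y\<^sub>0\<close> thus have the common denominator \<open>y\<^sub>0\<close>, which forces this fraction to be a
  monomial, and then \<open>y\<^sub>0\<close> to be constant. Hence the automorphism agrees with some \<open>\<phi>\<^bsub>\<tau>,c\<^esub>\<close> on all
  \<open>L \<alpha> 0\<close>. An automorphism fixing all \<open>L \<alpha> 0\<close> is \<open>\<complex>[\<Gamma>]\<close>-linear and commutes with \<open>\<partial>\<close>, and the
  image \<open>g\<close> of \<open>t\<close> satisfies \<open>g\<^sup>2 = \<partial>g\<close>, whose only nonzero solution is \<open>t\<close>; so it is the identity.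
\<close>

subsection \<open>Widths in the group ring of the reals\<close>

text \<open>At most one pair of exponents contributes to the convolution sum at
  \<open>a + b\<close>. This is applied to the extreme exponents of two factors.\<close>

lemma lookup_mult_unique:
  fixes f g :: "'a::monoid_add \<Rightarrow>\<^sub>0 'b::semiring_0"
  assumes "\<And>a' b'. a' \<in> Poly_Mapping.keys f \<Longrightarrow> b' \<in> Poly_Mapping.keys g \<Longrightarrow>
             a' + b' = a + b \<Longrightarrow> a' = a \<and> b' = b"
  shows "Poly_Mapping.lookup (f * g) (a + b) = Poly_Mapping.lookup f a * Poly_Mapping.lookup g b"
proof -
  let ?f = "Poly_Mapping.lookup f" and ?g = "Poly_Mapping.lookup g"
  have inner: "(\<Sum>q. ?g q when a + b = a' + q) = (?g b when a' = a)"
    if "a' \<in> Poly_Mapping.keys f" for a'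
  proof (cases "a' = a")
    case True
    have "(?g q when a + b = a' + q) = (?g q when q = b)" for q
      using assms[OF that, of q] True by (cases "?g q = 0") (auto simp: when_def in_keys_iff)
    then show ?thesis using True by simp
  next
    case False
    have "(?g q when a + b = a' + q) = 0" for q
      using assms[OF that, of q] False by (cases "?g q = 0") (auto simp: when_def in_keys_iff)
    then show ?thesis using False by simp
  qed
  have "?f a' * (\<Sum>q. ?g q when a + b = a' + q) = (?f a' * ?g b when a' = a)" for a'
    using inner[of a'] by (cases "?f a' = 0") (simp_all add: in_keys_iff mult_when)
  then show ?thesis by (simp add: lookup_mult)
qed

definition top_exp :: "(real \<Rightarrow>\<^sub>0 complex) \<Rightarrow> real" where
  "top_exp f = Max (Poly_Mapping.keys f)"

definition low_exp :: "(real \<Rightarrow>\<^sub>0 complex) \<Rightarrow> real" where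
  "low_exp f = Min (Poly_Mapping.keys f)"

text \<open>The length of the Newton interval; meaningful only for nonzero \<open>f\<close>, as
  \<open>Max\<close> and \<open>Min\<close> of the empty set are unspecified.\<close>

definition width :: "(real \<Rightarrow>\<^sub>0 complex) \<Rightarrow> real" where
  "width f = top_exp f - low_exp f"

lemma keys_nonempty: "f \<noteq> 0 \<Longrightarrow> Poly_Mapping.keys f \<noteq> {}"
  by (metis empty_iff in_keys_iff lookup_zero poly_mapping_eqI)

lemma top_exp_in_keys: "f \<noteq> 0 \<Longrightarrow> top_exp f \<in> Poly_Mapping.keys f"
  unfolding top_exp_def by (intro Max_in finite_keys keys_nonempty)

lemma low_exp_in_keys: "f \<noteq> 0 \<Longrightarrow> low_exp f \<in> Poly_Mapping.keys f"
  unfolding low_exp_def by (intro Min_in finite_keys keys_nonempty)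

lemma exp_bounds:
  "k \<in> Poly_Mapping.keys f \<Longrightarrow> k \<le> top_exp f"
  "k \<in> Poly_Mapping.keys f \<Longrightarrow> low_exp f \<le> k"
  by (simp_all add: top_exp_def low_exp_def)

lemma width_nonneg: "f \<noteq> 0 \<Longrightarrow> 0 \<le> width f"
  using exp_bounds(1)[OF low_exp_in_keys] by (simp add: width_def)

lemma lookup_top_mult:
  "Poly_Mapping.lookup (f * g) (top_exp f + top_exp g) =
     Poly_Mapping.lookup f (top_exp f) * Poly_Mapping.lookup g (top_exp g)"
proof (rule lookup_mult_unique)
  fix a b
  assume "a \<in> Poly_Mapping.keys f" "b \<in> Poly_Mapping.keys g" "a + b = top_exp f + top_exp g"
  then show "a = top_exp f \<and> b = top_exp g"
    using exp_bounds(1)[of a f] exp_bounds(1)[of b g] by linarith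
qed

lemma lookup_low_mult:
  "Poly_Mapping.lookup (f * g) (low_exp f + low_exp g) =
     Poly_Mapping.lookup f (low_exp f) * Poly_Mapping.lookup g (low_exp g)"
proof (rule lookup_mult_unique)
  fix a b
  assume "a \<in> Poly_Mapping.keys f" "b \<in> Poly_Mapping.keys g" "a + b = low_exp f + low_exp g"
  then show "a = low_exp f \<and> b = low_exp g"
    using exp_bounds(2)[of a f] exp_bounds(2)[of b g] by linarith
qed

lemma top_exp_mult:
  assumes "f \<noteq> 0" "g \<noteq> 0"
  shows "top_exp (f * g) = top_exp f + top_exp g"
proof (rule antisym)
  have "top_exp (f * g) \<in> Poly_Mapping.keys (f * g)"
    using assms by (intro top_exp_in_keys) simp
  then obtain a b where "a \<in> Poly_Mapping.keys f" "b \<in> Poly_Mapping.keys g" "top_exp (f * g) = a + b"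
    using keys_mult by blast
  then show "top_exp (f * g) \<le> top_exp f + top_exp g"
    by (simp add: add_mono exp_bounds)
  show "top_exp f + top_exp g \<le> top_exp (f * g)"
    using assms top_exp_in_keys by (intro exp_bounds) (simp add: in_keys_iff lookup_top_mult)
qed

lemma low_exp_mult:
  assumes "f \<noteq> 0" "g \<noteq> 0"
  shows "low_exp (f * g) = low_exp f + low_exp g"
proof (rule antisym)
  have "low_exp (f * g) \<in> Poly_Mapping.keys (f * g)"
    using assms by (intro low_exp_in_keys) simp
  then obtain a b where "a \<in> Poly_Mapping.keys f" "b \<in> Poly_Mapping.keys g" "low_exp (f * g) = a + b"
    using keys_mult by blast
  then show "low_exp f + low_exp g \<le> low_exp (f * g)"
    by (simp add: add_mono exp_bounds)
  show "low_exp (f * g) \<le> low_exp f + low_exp g"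
    using assms low_exp_in_keys by (intro exp_bounds) (simp add: in_keys_iff lookup_low_mult)
qed

lemma width_mult: "f \<noteq> 0 \<Longrightarrow> g \<noteq> 0 \<Longrightarrow> width (f * g) = width f + width g"
  by (simp add: width_def top_exp_mult low_exp_mult)

lemma width_power: "f \<noteq> 0 \<Longrightarrow> width (f ^ n) = n * width f"
proof (induction n)
  case 0
  have "Poly_Mapping.keys (1 :: real \<Rightarrow>\<^sub>0 complex) = {0}" by simp
  then show ?case by (simp add: width_def top_exp_def low_exp_def)
qed (simp add: width_mult algebra_simps)

text \<open>The hypothesis says that every power of \<open>s / x\<close> has denominator
  \<open>x\<close>. Hence \<open>width s - width x\<close> is at least \<open>- width x / n\<close>
  for all positive \<open>n\<close>.\<close>

lemma width_le_of_powers: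
  assumes "x \<noteq> 0" "s \<noteq> 0" and "\<And>n::nat. \<exists>z. s ^ n * x = x ^ n * z"
  shows "width x \<le> width s"
proof (rule ccontr)
  assume "\<not> width x \<le> width s"
  then obtain n :: nat where n: "width x < n * (width x - width s)"
    using reals_Archimedean3[of "width x - width s"] by auto
  obtain z where z: "s ^ n * x = x ^ n * z" using assms(3) by blast
  have "z \<noteq> 0" using z assms(1,2) by auto
  then have "n * width s + width x = n * width x + width z"
    using arg_cong[OF z, of width] assms(1,2) by (simp add: width_mult width_power)
  with n width_nonneg[OF \<open>z \<noteq> 0\<close>] show False by (simp add: algebra_simps)
qed

text \<open>Think of \<open>Y\<close> as a geometric progression with ratio
  \<open>q = y / x\<close>. Then \<open>(q - m) ^ n * Y 0\<close> is a combination of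
  \<open>Y 0, ..., Y n\<close> over the ring, and this is \<open>z\<close>.\<close>

lemma shifted_ratio_powers:
  fixes y :: "'a::comm_ring_1" and Y :: "int \<Rightarrow> 'a"
  assumes "\<And>j. y * Y j = x * Y (j + 1)"
  shows "\<exists>z. (y - m * x) ^ n * Y 0 = x ^ n * z"
  using assms
proof (induction n arbitrary: Y)
  case (Suc n)
  \<comment> \<open>Multiplication by \<open>q - m\<close> turns \<open>Y\<close> into
    \<open>Y'\<close>, a progression with the same ratio.\<close>
  define Y' where "Y' j = Y (j + 1) - m * Y j" for j
  have step: "(y - m * x) * Y 0 = x * Y' 0"
    using Suc.prems[of 0] by (simp add: Y'_def algebra_simps)
  have "y * Y' j = x * Y' (j + 1)" for j
    using Suc.prems[of j] Suc.prems[of "j + 1"]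
    by (simp add: Y'_def right_diff_distrib mult.left_commute[of y m] mult.left_commute[of x m])
  then obtain z where "(y - m * x) ^ n * Y' 0 = x ^ n * z"
    using Suc.IH by blast
  moreover have "(y - m * x) ^ Suc n * Y 0 = x * ((y - m * x) ^ n * Y' 0)"
    unfolding power_Suc2 mult.assoc step by (rule mult.left_commute)
  ultimately have "(y - m * x) ^ Suc n * Y 0 = x ^ Suc n * z"
    by (simp add: mult.assoc)
  then show ?case by blast
qed auto

text \<open>Both \<open>y / x\<close> and \<open>x / y\<close> have all powers with denominator \<open>x\<close>, which forces
  equal widths. Subtracting the monomial that cancels the leading term of \<open>y / x\<close> would then
  leave a fraction of negative width with the same property.\<close>
lemma geometric_ratio_monomial:
  fixes Y :: "int \<Rightarrow> real \<Rightarrow>\<^sub>0 complex"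
  assumes mult: "\<And>i j. Y i * Y j = Y 0 * Y (i + j)" and nz: "Y 0 \<noteq> 0"
  defines "\<rho> \<equiv> top_exp (Y 1) - top_exp (Y 0)"
  shows "\<exists>c. c \<noteq> 0 \<and> Y 1 = Poly_Mapping.single \<rho> c * Y 0"
proof -
  have Ynz: "Y i \<noteq> 0" for i
  proof
    assume "Y i = 0"
    then have "Y 0 * Y 0 = 0" using mult[of i "- i"] by simp
    then show False using nz by simp
  qed
  have step: "\<exists>z. (Y i - m * Y 0) ^ n * Y 0 = Y 0 ^ n * z" for i m n
  proof -
    \<comment> \<open>The terms with index divisible by \<open>i\<close> form a progression with
      ratio \<open>Y i / Y 0\<close>; negative \<open>i\<close> gives the inverse ratios.\<close>
    have "Y i * Y (i * j) = Y 0 * Y (i * (j + 1))" for j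
      unfolding mult[of i "i * j"] by (simp add: algebra_simps)
    from shifted_ratio_powers[of "Y i" "\<lambda>j. Y (i * j)" "Y 0" m n, OF this]
    show ?thesis by simp
  qed
  have le: "width (Y 0) \<le> width (Y i)" for i
    using step[of i 0] Ynz by (intro width_le_of_powers) auto
  \<comment> \<open>Neither summand is below \<open>width (Y 0)\<close>, so both equal it.\<close>
  have "width (Y 1) + width (Y (-1)) = 2 * width (Y 0)"
    using arg_cong[OF mult[of 1 "-1"], of width] Ynz by (simp add: width_mult)
  with le[of 1] le[of "-1"] have width1: "width (Y 1) = width (Y 0)" by linarith
  \<comment> \<open>The choice of \<open>c\<close> and \<open>\<rho>\<close> gives
    \<open>m * Y 0\<close> the leading term of \<open>Y 1\<close>.\<close>
  define c where "c = Poly_Mapping.lookup (Y 1) (top_exp (Y 1)) / Poly_Mapping.lookup (Y 0) (top_exp (Y 0))"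
  define m where "m = Poly_Mapping.single \<rho> c"
  have "c \<noteq> 0"
    using top_exp_in_keys[OF Ynz] by (simp add: c_def in_keys_iff)
  then have keys_m: "Poly_Mapping.keys m = {\<rho>}"
    by (simp add: m_def)
  then have mnz: "m \<noteq> 0" by auto
  from keys_m have exps: "top_exp m = \<rho>" "low_exp m = \<rho>"
    by (simp_all add: top_exp_def low_exp_def)
  have top_mY: "top_exp (m * Y 0) = top_exp (Y 1)"
    using mnz nz by (simp add: top_exp_mult exps \<rho>_def)
  have low_mY: "low_exp (m * Y 0) = low_exp (Y 1)"
    using mnz nz width1 by (simp add: low_exp_mult exps \<rho>_def width_def)
  have "Y 1 - m * Y 0 = 0"
  proof (rule ccontr)
    let ?s = "Y 1 - m * Y 0"
    assume s: "?s \<noteq> 0"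
    have keys_s: "Poly_Mapping.keys ?s \<subseteq> Poly_Mapping.keys (Y 1) \<union> Poly_Mapping.keys (m * Y 0)"
    proof
      fix k assume "k \<in> Poly_Mapping.keys ?s"
      then have "Poly_Mapping.lookup (Y 1) k - Poly_Mapping.lookup (m * Y 0) k \<noteq> 0"
        by (simp only: in_keys_iff lookup_minus not_False_eq_True)
      then have "Poly_Mapping.lookup (Y 1) k \<noteq> 0 \<or> Poly_Mapping.lookup (m * Y 0) k \<noteq> 0"
        by fastforce
      then show "k \<in> Poly_Mapping.keys (Y 1) \<union> Poly_Mapping.keys (m * Y 0)"
        by (simp only: in_keys_iff Un_iff not_False_eq_True)
    qed
    \<comment> \<open>By equality of widths the lowest exponents of \<open>Y 1\<close> and
      \<open>m * Y 0\<close> agree as well. With the leading terms cancelled, the exponents of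
      \<open>?s\<close> fit into a strictly shorter interval.\<close>
    have "low_exp (Y 1) \<le> low_exp ?s"
      using subsetD[OF keys_s low_exp_in_keys[OF s]] exp_bounds(2)[of "low_exp ?s"] low_mY
      by (metis UnE)
    moreover have "top_exp ?s \<le> top_exp (Y 1)"
      using subsetD[OF keys_s top_exp_in_keys[OF s]] exp_bounds(1)[of "top_exp ?s"] top_mY
      by (metis UnE)
    moreover have "Poly_Mapping.lookup (m * Y 0) (\<rho> + top_exp (Y 0)) =
        c * Poly_Mapping.lookup (Y 0) (top_exp (Y 0))"
      using lookup_top_mult[of m "Y 0"] unfolding exps by (simp add: m_def)
    then have "Poly_Mapping.lookup (m * Y 0) (top_exp (Y 1)) =
        Poly_Mapping.lookup (Y 1) (top_exp (Y 1))"
      using top_exp_in_keys[OF nz] by (simp add: \<rho>_def c_def in_keys_iff)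
    then have "Poly_Mapping.lookup ?s (top_exp (Y 1)) = 0"
      by (simp only: lookup_minus diff_self)
    then have "top_exp ?s \<noteq> top_exp (Y 1)"
      using top_exp_in_keys[OF s] by (auto simp: in_keys_iff)
    ultimately have "width ?s < width (Y 0)"
      using width1 by (simp add: width_def)
    moreover have "width (Y 0) \<le> width ?s"
      using nz s step by (intro width_le_of_powers)
    ultimately show False by simp
  qed
  then show ?thesis using \<open>c \<noteq> 0\<close> by (auto simp: m_def)
qed

subsection \<open>The algebra of vector fields\<close>

lemma scale_mult: "scale c x * y = scale c (x * y)" "x * scale c y = scale c (x * y)"
  unfolding scale_def mult_map_scale_conv_mult by (simp_all add: mult.assoc mult.left_commute)

text \<open>The product on \<open>vec\<close> is convolution over pairs with componentwise addition,
  so \<open>L \<alpha> i\<close> is the monomial \<open>x^\<alpha> t^i\<close>.\<close>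

lemma L_mult: "L \<alpha> i * L \<beta> j = L (\<alpha> + \<beta>) (i + j)"
  by (simp add: L_def mult_single)

lemma L_0_0: "L 0 0 = 1"
  by (simp add: L_def flip: zero_prod_def)

lemma L_nonzero: "L \<alpha> i \<noteq> 0"
  by (simp add: L_def flip: keys_eq_empty)

lemma scale_minus: "scale c (x - y) = scale c x - scale c y"
  by (rule poly_mapping_eqI) (simp add: lookup_minus algebra_simps)

lemma scale_eq_0: "scale c x = 0 \<longleftrightarrow> c = 0 \<or> x = 0"
  by (auto simp: poly_mapping_eq_iff fun_eq_iff)

lemma lin_ext_eq_on:
  assumes "x \<in> W \<Gamma>" "\<And>x y. x \<in> W \<Gamma> \<Longrightarrow> y \<in> W \<Gamma> \<Longrightarrow> f (x + y) = f x + f y"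
    and "\<And>c x. x \<in> W \<Gamma> \<Longrightarrow> f (scale c x) = scale c (f x)"
  shows "f x = lin_ext (\<lambda>\<alpha> i. f (L \<alpha> i)) x"
proof -
  have f0: "f 0 = 0"
    using assms(3)[OF W_closed(1), of 0] by (simp add: scale_simps)
  have sum: "sum g A \<in> W \<Gamma> \<and> f (sum g A) = (\<Sum>a\<in>A. f (g a))"
    if "\<And>a. a \<in> A \<Longrightarrow> g a \<in> W \<Gamma>" for g and A :: "(complex \<times> nat) set"
    using that by (induction A rule: infinite_finite_induct) (auto simp: f0 W_closed assms(2))
  have keys: "fst a \<in> \<Gamma>" if "a \<in> Poly_Mapping.keys x" for a
    using that assms(1) by (auto simp: W_def)
  have "f x = f (lin_ext L x)" by (simp only: lin_ext_basis)
  also have "\<dots> = lin_ext (\<lambda>\<alpha> i. f (L \<alpha> i)) x"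
    unfolding lin_ext_def split_def using keys by (subst sum[THEN conjunct2]) (auto simp: W_closed assms(3))
  finally show ?thesis .
qed

text \<open>The derivation with \<open>x^a -> a x^a\<close> and \<open>t -> t^2\<close>; the shift
  to \<open>i + 1\<close> comes from \<open>i t^(i - 1) t^2\<close>.\<close>

definition deriv :: "vec \<Rightarrow> vec" where
  "deriv = lin_ext (\<lambda>\<alpha> i. scale \<alpha> (L \<alpha> i) + scale (of_nat i) (L \<alpha> (i + 1)))"

lemma deriv_add: "deriv (x + y) = deriv x + deriv y"
  by (simp add: deriv_def lin_ext_add)

lemma deriv_scale: "deriv (scale c x) = scale c (deriv x)"
  by (simp add: deriv_def lin_ext_scale)

lemma deriv_L: "deriv (L \<alpha> i) = scale \<alpha> (L \<alpha> i) + scale (of_nat i) (L \<alpha> (i + 1))"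
  by (simp add: deriv_def)

lemma deriv_mult: "deriv (x * y) = x * deriv y + y * deriv x"
proof (induction x rule: vec_induct)
  case (L \<alpha> i)
  show ?case
  proof (induction y rule: vec_induct)
    case (L \<beta> j)
    show ?case
      unfolding L_mult deriv_L distrib_left scale_mult
      by (rule poly_mapping_eqI) (simp add: L_mult lookup_add algebra_simps)
  qed (simp_all add: scale_mult deriv_scale deriv_add scale_simps algebra_simps)
qed (simp_all add: scale_mult deriv_scale deriv_add scale_simps algebra_simps)

text \<open>From here on Lie brackets are computed in a commutative ring with a derivation, where
  common factors can be cancelled.\<close>

lemma bracket_eq: "bracket x y = x * deriv y - y * deriv x"
proof (induction x rule: vec_induct)
  case (L \<alpha> i)
  show ?case
  proof (induction y rule: vec_induct)
    case (L \<beta> j)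
    show ?case
      unfolding bracket_L deriv_L distrib_left scale_mult
      by (rule poly_mapping_eqI) (simp add: L_mult lookup_add lookup_minus algebra_simps)
  next
    case (scale c y)
    then show ?case by (simp add: scale_mult deriv_scale bracket_bilinear flip: scale_minus)
  next
    case (add y z)
    then show ?case by (simp add: deriv_add bracket_bilinear distrib_left distrib_right)
  qed
next
  case (scale c x)
  then show ?case by (simp add: scale_mult deriv_scale bracket_bilinear flip: scale_minus)
next
  case (add x z)
  then show ?case by (simp add: deriv_add bracket_bilinear distrib_left distrib_right)
qed

lemma deriv_closed: "x \<in> W \<Gamma> \<Longrightarrow> deriv x \<in> W \<Gamma>"
  unfolding deriv_def by (rule lin_ext_closed) (simp_all add: W_closed)

subsection \<open>Ordering the exponents\<close>

text \<open>The heights of distinct exponents differ by a nonzero polynomial in \<open>s\<close>, so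
  any finite set of exponents is separated once \<open>s\<close> is large. Multiplication by
  \<open>t\<close> raises the height by exactly 1.\<close>

definition height :: "real \<Rightarrow> complex \<times> nat \<Rightarrow> real" where
  "height s k = s\<^sup>2 * Re (fst k) + s * Im (fst k) + of_nat (snd k)"

lemma height_add: "height s (k + l) = height s k + height s l"
  by (simp add: height_def algebra_simps)

lemma eventually_quadratic_large:
  fixes a b c M :: real
  assumes "a \<noteq> 0 \<or> b \<noteq> 0"
  shows "\<forall>\<^sub>F s in at_top. M < \<bar>s\<^sup>2 * a + s * b + c\<bar>"
proof (cases "a = 0")
  case True
  with assms have b: "b \<noteq> 0" by simp
  have "M < \<bar>s * b + c\<bar>" if "s \<ge> (\<bar>M\<bar> + \<bar>c\<bar> + 1) / \<bar>b\<bar>" for s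
  proof -
    have "\<bar>M\<bar> + \<bar>c\<bar> + 1 \<le> s * \<bar>b\<bar>" using that b by (simp add: field_simps)
    also have "\<dots> \<le> \<bar>s * b\<bar>" by (simp add: abs_mult mult_right_mono)
    finally show ?thesis by linarith
  qed
  then show ?thesis using True by (auto simp: eventually_at_top_linorder)
next
  case False
  have "M < \<bar>s\<^sup>2 * a + s * b + c\<bar>" if s: "s \<ge> max 1 ((\<bar>M\<bar> + \<bar>b\<bar> + \<bar>c\<bar> + 1) / \<bar>a\<bar>)" for s
  proof -
    have "\<bar>M\<bar> + \<bar>b\<bar> + \<bar>c\<bar> + 1 \<le> s * \<bar>a\<bar>" using s False by (simp add: field_simps)
    then have "s * (\<bar>M\<bar> + \<bar>b\<bar> + \<bar>c\<bar> + 1) \<le> s * (s * \<bar>a\<bar>)" using s by (intro mult_left_mono) auto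
    moreover have "\<bar>M\<bar> + \<bar>c\<bar> + 1 \<le> s * (\<bar>M\<bar> + \<bar>c\<bar> + 1)"
      using s mult_right_mono[of 1 s "\<bar>M\<bar> + \<bar>c\<bar> + 1"] by simp
    moreover have "\<bar>s * b\<bar> = s * \<bar>b\<bar>" "\<bar>s\<^sup>2 * a\<bar> = s * (s * \<bar>a\<bar>)"
      using s by (simp_all add: abs_mult power2_eq_square)
    ultimately show ?thesis by (simp add: distrib_left) linarith
  qed
  then show ?thesis unfolding eventually_at_top_linorder by blast
qed

text \<open>This tells exponents apart by size: those of pure powers \<open>t^i\<close> keep height
  \<open>i\<close> for every \<open>s\<close>.\<close>

lemma eventually_height_large:
  assumes "\<alpha> \<noteq> 0"
  shows "\<forall>\<^sub>F s in at_top. M < \<bar>height s (\<alpha>, i)\<bar>"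
  using eventually_quadratic_large[of "Re \<alpha>" "Im \<alpha>"] assms by (simp add: height_def complex_eq_iff)

lemma eventually_inj_on_height:
  assumes "finite K"
  shows "\<forall>\<^sub>F s in at_top. inj_on (height s) K"
proof -
  have "\<forall>\<^sub>F s in at_top. height s k = height s l \<longrightarrow> k = l" for k l
  proof (cases "fst k = fst l")
    case True
    then show ?thesis by (auto simp: height_def prod_eq_iff)
  next
    case False
    then have "\<forall>\<^sub>F s in at_top. 0 < \<bar>s\<^sup>2 * Re (fst k - fst l) + s * Im (fst k - fst l) +
        (of_nat (snd k) - of_nat (snd l))\<bar>"
      by (intro eventually_quadratic_large) (auto simp: complex_eq_iff)
    then show ?thesis
      by eventually_elim (auto simp: height_def algebra_simps)
  qed
  then have "\<forall>\<^sub>F s in at_top. \<forall>k\<in>K. \<forall>l\<in>K. height s k = height s l \<longrightarrow> k = l"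
    using assms by (simp add: eventually_ball_finite_distrib)
  then show ?thesis by (simp add: inj_on_def)
qed

text \<open>Reading \<open>x\<^sup>\<alpha> t\<^sup>i\<close> as \<open>e\<^sup>r\<close> with \<open>r = height s (\<alpha>, i)\<close> is a ring homomorphism into the group
  ring of the ordered group \<open>\<real>\<close>; for large \<open>s\<close> it is injective on any given finite set of exponents.\<close>
definition collapse :: "real \<Rightarrow> vec \<Rightarrow> real \<Rightarrow>\<^sub>0 complex" where
  "collapse s x = (\<Sum>k\<in>Poly_Mapping.keys x. Poly_Mapping.single (height s k) (Poly_Mapping.lookup x k))"

lemma collapse_superset:
  assumes "finite S" "Poly_Mapping.keys x \<subseteq> S"
  shows "collapse s x = (\<Sum>k\<in>S. Poly_Mapping.single (height s k) (Poly_Mapping.lookup x k))"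
  unfolding collapse_def using assms
  by (intro sum.mono_neutral_left) (auto simp: in_keys_iff)

lemma collapse_add: "collapse s (x + y) = collapse s x + collapse s y"
proof -
  let ?S = "Poly_Mapping.keys x \<union> Poly_Mapping.keys y"
  have "Poly_Mapping.keys (x + y) \<subseteq> ?S" by (rule keys_add)
  then show ?thesis
    by (simp add: collapse_superset[of ?S] lookup_add single_add flip: sum.distrib)
qed

lemma collapse_scale: "collapse s (scale c x) = Poly_Mapping.single 0 c * collapse s x"
proof -
  have "Poly_Mapping.keys (scale c x) \<subseteq> Poly_Mapping.keys x" by (auto simp: in_keys_iff)
  then show ?thesis
    by (simp add: collapse_superset[of "Poly_Mapping.keys x"] sum_distrib_left mult_single)
qed

lemma collapse_L: "collapse s (L \<alpha> i) = Poly_Mapping.single (height s (\<alpha>, i)) 1"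
  by (simp add: collapse_def L_def)

lemma collapse_mult: "collapse s (x * y) = collapse s x * collapse s y"
proof (induction x rule: vec_induct)
  case (L \<alpha> i)
  show ?case
  proof (induction y rule: vec_induct)
    case (L \<beta> j)
    show ?case
      by (simp add: L_mult collapse_L mult_single height_add[of s "(\<alpha>, i)" "(\<beta>, j)", simplified])
  qed (simp_all add: scale_mult collapse_scale collapse_add algebra_simps)
qed (simp_all add: scale_mult collapse_scale collapse_add algebra_simps)

lemma lookup_collapse:
  assumes "inj_on (height s) K" "Poly_Mapping.keys x \<subseteq> K" "k \<in> K"
  shows "Poly_Mapping.lookup (collapse s x) (height s k) = Poly_Mapping.lookup x k"
proof -
  have "Poly_Mapping.lookup (collapse s x) (height s k) =
      (\<Sum>l\<in>Poly_Mapping.keys x. if l = k then Poly_Mapping.lookup x l else 0)"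
    unfolding collapse_def lookup_sum
    using assms by (intro sum.cong) (auto simp: lookup_single when_def inj_on_def)
  then show ?thesis by (simp add: in_keys_iff)
qed

lemma keys_collapse_subset: "Poly_Mapping.keys (collapse s x) \<subseteq> height s ` Poly_Mapping.keys x"
proof
  fix r assume "r \<in> Poly_Mapping.keys (collapse s x)"
  then obtain k where "k \<in> Poly_Mapping.keys x"
    "Poly_Mapping.lookup (Poly_Mapping.single (height s k) (Poly_Mapping.lookup x k)) r \<noteq> 0"
    unfolding collapse_def in_keys_iff lookup_sum by (blast elim: sum.not_neutral_contains_not_neutral)
  then show "r \<in> height s ` Poly_Mapping.keys x"
    by (auto simp: lookup_single when_def split: if_splits)
qed

lemma keys_collapse:
  assumes "inj_on (height s) (Poly_Mapping.keys x)"
  shows "Poly_Mapping.keys (collapse s x) = height s ` Poly_Mapping.keys x"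
  using keys_collapse_subset lookup_collapse[OF assms subset_refl]
  by (fastforce simp: in_keys_iff)

lemma collapse_injective:
  assumes "inj_on (height s) (Poly_Mapping.keys x \<union> Poly_Mapping.keys y)"
    and "collapse s x = collapse s y"
  shows "x = y"
proof (rule poly_mapping_eqI)
  fix k
  show "Poly_Mapping.lookup x k = Poly_Mapping.lookup y k"
    using lookup_collapse[OF assms(1), of x k] lookup_collapse[OF assms(1), of y k] assms(2)
    by (cases "k \<in> Poly_Mapping.keys x \<union> Poly_Mapping.keys y") (auto simp: in_keys_iff)
qed

lemma exists_injective_height:
  assumes "finite K" obtains s where "inj_on (height s) K"
  using eventually_happens[OF eventually_inj_on_height[OF assms]] by auto

lemma collapse_eq_0: "inj_on (height s) (Poly_Mapping.keys x) \<Longrightarrow> collapse s x = 0 \<longleftrightarrow> x = 0"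
  by (metis keys_collapse keys_eq_empty image_is_empty)

text \<open>Absence of zero divisors is inherited from the group ring of the ordered group of reals,
  along a collapse that is injective on both supports.\<close>

lemma vec_mult_eq_0:
  fixes x y :: vec
  shows "x * y = 0 \<longleftrightarrow> x = 0 \<or> y = 0"
proof
  assume xy: "x * y = 0"
  obtain s where s: "inj_on (height s) (Poly_Mapping.keys x \<union> Poly_Mapping.keys y)"
    using exists_injective_height[of "Poly_Mapping.keys x \<union> Poly_Mapping.keys y"] by auto
  have "collapse s x * collapse s y = 0"
    using xy by (simp flip: collapse_mult) (simp add: collapse_def)
  then show "x = 0 \<or> y = 0"
    using s by (simp add: collapse_eq_0 inj_on_Un)
qed auto

lemma vec_mult_left_cancel: "x \<noteq> 0 \<Longrightarrow> x * y = x * z \<Longrightarrow> y = z" for x y z :: vec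
  using vec_mult_eq_0[of x "y - z"] by (simp add: right_diff_distrib)

subsection \<open>Images of the elements \<open>L a 0\<close>\<close>

text \<open>This is \<open>geometric_ratio_monomial\<close> pulled back along a collapse. The ratio
  may contain a negative power of \<open>t\<close>, hence the cross-multiplied form.\<close>

lemma vec_ratio_monomial:
  fixes y :: "int \<Rightarrow> vec"
  assumes mult: "\<And>i j. y i * y j = y 0 * y (i + j)" and nz: "y 0 \<noteq> 0"
  shows "\<exists>c a i b j. c \<noteq> 0 \<and> L a i * y 1 = scale c (L b j * y 0)"
proof -
  define K where "K = Poly_Mapping.keys (y 0) \<union> Poly_Mapping.keys (y 1)"
  \<comment> \<open>The two products compared at the end have their exponents in
    \<open>K + K\<close>; including \<open>K\<close> keeps the collapse of \<open>y 0\<close>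
    nonzero.\<close>
  define S where "S = K \<union> (\<lambda>(k, l). k + l) ` (K \<times> K)"
  have "finite S" by (simp add: S_def K_def)
  then obtain s where inj: "inj_on (height s) S" by (rule exists_injective_height)
  define Y where "Y i = collapse s (y i)" for i
  have "inj_on (height s) (Poly_Mapping.keys (y 0))"
    using inj by (rule inj_on_subset) (auto simp: S_def K_def)
  then have Y0: "Y 0 \<noteq> 0"
    using nz by (simp add: Y_def collapse_eq_0)
  have "Y i * Y j = Y 0 * Y (i + j)" for i j
    unfolding Y_def collapse_mult[symmetric] mult[of i j] ..
  from geometric_ratio_monomial[of Y, OF this Y0] obtain c where c: "c \<noteq> 0"
    and Y1: "Y 1 = Poly_Mapping.single (top_exp (Y 1) - top_exp (Y 0)) c * Y 0"
    by blast
  have "Poly_Mapping.single (top_exp (Y 1) - top_exp (Y 0)) c \<noteq> 0"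
    using c by (simp flip: keys_eq_empty)
  then have Y1nz: "Y 1 \<noteq> 0"
    using Y0 Y1 by (metis mult_eq_0_iff)
  \<comment> \<open>The leading exponents after the collapse come from actual exponents
    \<open>k\<close> of \<open>y 0\<close> and \<open>l\<close> of \<open>y 1\<close>, which supply
    the two monomials.\<close>
  obtain k where k: "k \<in> Poly_Mapping.keys (y 0)" "top_exp (Y 0) = height s k"
    using top_exp_in_keys[OF Y0] keys_collapse_subset[of s "y 0"] unfolding Y_def by blast
  obtain l where l: "l \<in> Poly_Mapping.keys (y 1)" "top_exp (Y 1) = height s l"
    using top_exp_in_keys[OF Y1nz] keys_collapse_subset[of s "y 1"] unfolding Y_def by blast
  have L_case: "L (fst m) (snd m) = Poly_Mapping.single m 1" for m
    by (simp add: L_def)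
  have collapse_single: "collapse s (L (fst m) (snd m)) = Poly_Mapping.single (height s m) 1" for m
    by (simp add: collapse_L)
  have "collapse s (L (fst k) (snd k) * y 1) =
      Poly_Mapping.single (height s k) 1 * Y 1"
    by (simp add: collapse_mult collapse_single Y_def)
  also have "\<dots> = Poly_Mapping.single (height s k) 1 *
      (Poly_Mapping.single (height s l - height s k) c * Y 0)"
    using Y1 k(2) l(2) by simp
  also have "\<dots> = Poly_Mapping.single 0 c * (Poly_Mapping.single (height s l) 1 * Y 0)"
    by (simp add: mult_single flip: mult.assoc)
  also have "\<dots> = collapse s (scale c (L (fst l) (snd l) * y 0))"
    by (simp add: collapse_scale collapse_mult collapse_single Y_def)
  finally have eq: "collapse s (L (fst k) (snd k) * y 1) = collapse s (scale c (L (fst l) (snd l) * y 0))" .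
  have "Poly_Mapping.keys (L (fst k) (snd k) * y 1) \<subseteq> S"
    using keys_mult[of "L (fst k) (snd k)" "y 1"] k(1) by (force simp: L_case S_def K_def)
  moreover have "Poly_Mapping.keys (scale c (L (fst l) (snd l) * y 0)) \<subseteq>
      Poly_Mapping.keys (L (fst l) (snd l) * y 0)"
    by (auto simp: in_keys_iff)
  moreover have "Poly_Mapping.keys (L (fst l) (snd l) * y 0) \<subseteq> S"
    using keys_mult[of "L (fst l) (snd l)" "y 0"] l(1) by (force simp: L_case S_def K_def)
  ultimately have "L (fst k) (snd k) * y 1 = scale c (L (fst l) (snd l) * y 0)"
    by (intro collapse_injective[OF inj_on_subset[OF inj] eq]) auto
  then show ?thesis using c by blast
qed

text \<open>The second factor divides a nonzero constant. With \<open>m \<noteq> 0\<close> this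
  fails: for \<open>b = 0\<close> the product has no constant term, and for
  \<open>b \<noteq> 0\<close> the factor collapses to width 1, while constants have width 0.\<close>

lemma linear_in_t_unit:
  assumes "x * (scale b 1 + scale m (L 0 1)) = scale a 1" "a \<noteq> 0"
  shows "m = 0" "b \<noteq> 0" "x = scale (a / b) 1"
proof -
  have one: "Poly_Mapping.lookup (1 :: vec) k = (if k = (0, 0) then 1 else 0)" for k
    by (simp add: lookup_one when_def zero_prod_def)
  have one_nz: "scale a (1 :: vec) \<noteq> 0"
    using \<open>a \<noteq> 0\<close> by (simp add: scale_eq_0)
  show m: "m = 0"
  proof (rule ccontr)
    assume m: "m \<noteq> 0"
    show False
    proof (cases "b = 0")
      case True
      then have "scale a 1 = scale m (x * L 0 1)"
        using assms(1) by (simp add: scale_simps scale_mult)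
      then have "Poly_Mapping.lookup (scale m (x * L 0 1)) (0, 0) = a"
        by (metis lookup_scale one mult.right_neutral)
      then have "(0, 0) \<in> Poly_Mapping.keys (x * L 0 1)"
        using \<open>a \<noteq> 0\<close> by (auto simp: in_keys_iff)
      then show False
        using keys_mult[of x "L 0 1"] by (auto simp: L_def)
    next
      case False
      obtain s where "inj_on (height s) (Poly_Mapping.keys x)"
        using exists_injective_height[of "Poly_Mapping.keys x"] by auto
      moreover have "x \<noteq> 0" using assms(1) one_nz by auto
      ultimately have X: "collapse s x \<noteq> 0" by (simp add: collapse_eq_0)
      let ?p = "Poly_Mapping.single 0 b + Poly_Mapping.single 1 m :: real \<Rightarrow>\<^sub>0 complex"
      have collapse1: "collapse s 1 = Poly_Mapping.single 0 1"
        by (simp add: collapse_L height_def flip: L_0_0)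
      have prod: "collapse s x * ?p = Poly_Mapping.single 0 a"
        using arg_cong[OF assms(1), of "collapse s"]
        by (simp add: collapse_mult collapse_add collapse_scale collapse1 collapse_L mult_single height_def
            del: single_one)
      have "Poly_Mapping.keys ?p = {0, 1}"
        using m False by (auto simp: in_keys_iff lookup_add lookup_single when_def split: if_splits)
      then have "width ?p = 1" "?p \<noteq> 0"
        by (auto simp: width_def top_exp_def low_exp_def simp flip: keys_eq_empty)
      moreover have "width (Poly_Mapping.single 0 a) = 0"
        using \<open>a \<noteq> 0\<close> by (simp add: width_def top_exp_def low_exp_def)
      ultimately show False
        using width_mult[of "collapse s x" ?p] width_nonneg[OF X] X prod by simp
    qed
  qed
  then have x: "scale b x = scale a 1"
    using assms(1) by (simp add: scale_simps scale_mult)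
  then show "b \<noteq> 0" using one_nz by (auto simp: scale_simps)
  then have "x = scale (1 / b) (scale b x)" by (simp add: scale_simps)
  then show "x = scale (a / b) 1" by (simp only: x scale_simps) simp
qed

text \<open>The second factor is the logarithmic derivative of the monomial.\<close>

lemma deriv_L_factor: "deriv (L a i) = L a i * (scale a 1 + scale (of_nat i) (L 0 1))"
  by (simp add: deriv_L distrib_left scale_mult L_mult)

text \<open>Eliminating the derivatives between the bracket relations leaves this purely
  multiplicative one: the elements \<open>y a\<close> form a geometric progression with ratios \<open>y a / y 0\<close>.\<close>
lemma witt_subalgebra_mult:
  fixes y :: "complex \<Rightarrow> vec"
  assumes \<Gamma>: "0 \<in> \<Gamma>" "\<And>a b. a \<in> \<Gamma> \<Longrightarrow> b \<in> \<Gamma> \<Longrightarrow> a + b \<in> \<Gamma>" "\<And>a. a \<in> \<Gamma> \<Longrightarrow> - a \<in> \<Gamma>"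
    and nz: "y 0 \<noteq> 0"
    and br: "\<And>a b. a \<in> \<Gamma> \<Longrightarrow> b \<in> \<Gamma> \<Longrightarrow> bracket (y a) (y b) = scale (b - a) (y (a + b))"
    and ab: "a \<in> \<Gamma>" "b \<in> \<Gamma>"
  shows "y a * y b = y 0 * y (a + b)"
proof -
  have E: "y 0 * deriv (y a) = scale a (y a) + y a * deriv (y 0)" if "a \<in> \<Gamma>" for a
    using br[OF \<Gamma>(1) that] by (simp add: bracket_eq algebra_simps)
  \<comment> \<open>Multiplying the bracket relation by \<open>y 0\<close> and inserting
    \<open>E\<close> cancels the terms with \<open>deriv (y 0)\<close>. What remains carries a
    factor \<open>b - a\<close>, so the diagonal needs its own argument.\<close>
  have mult_neq: "y a * y b = y 0 * y (a + b)" if ab: "a \<in> \<Gamma>" "b \<in> \<Gamma>" "a \<noteq> b" for a b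
  proof -
    have "y 0 * scale (b - a) (y (a + b)) = y 0 * bracket (y a) (y b)"
      by (simp add: br ab)
    also have "\<dots> = y a * (y 0 * deriv (y b)) - y b * (y 0 * deriv (y a))"
      by (simp add: bracket_eq algebra_simps)
    also have "\<dots> = scale b (y a * y b) - scale a (y a * y b)"
      by (simp add: E ab scale_mult distrib_left mult_ac)
    also have "\<dots> = scale (b - a) (y a * y b)"
      by (rule poly_mapping_eqI) (simp add: lookup_minus algebra_simps)
    finally have "scale (b - a) (y a * y b - y 0 * y (a + b)) = 0"
      by (simp add: scale_mult scale_minus)
    then show ?thesis using ab(3) by (simp add: scale_eq_0)
  qed
  show ?thesis
  proof (cases "a = b \<and> a \<noteq> 0")
    case True
    \<comment> \<open>The diagonal case takes a detour through \<open>- a\<close> and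
      \<open>a + a\<close>: both products used have distinct indices.\<close>
    then have neq: "a \<noteq> - a" "- a \<noteq> a + a"
      by (auto simp: eq_neg_iff_add_eq_0 add.commute[of "- a"] neg_eq_iff_add_eq_0)
    have "y (- a) * y (a + a) = y 0 * y (- a + (a + a))"
      by (intro mult_neq \<Gamma> ab neq)
    then have "y 0 * (y a * y a) = y a * (y (- a) * y (a + a))"
      by (simp only: minus_add_cancel mult_ac)
    also have "\<dots> = y 0 * (y 0 * y (a + a))"
      using mult_neq[of a "- a"] neq ab \<Gamma> by (simp flip: mult.assoc)
    finally show ?thesis using nz True by (auto dest: vec_mult_left_cancel)
  qed (use mult_neq[OF ab] in \<open>auto simp: mult.commute\<close>)
qed

text \<open>The ratio \<open>y a / y 0\<close> is a monomial \<open>x\<^sup>b t\<^sup>m\<close>, and then the bracket of \<open>y 0\<close> with \<open>y a\<close> gives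
  \<open>y 0 * (b + m t) = a\<close>, so that \<open>y 0\<close> is constant and \<open>m = 0\<close>.\<close>
lemma witt_subalgebra_form:
  fixes y :: "complex \<Rightarrow> vec"
  assumes \<Gamma>: "0 \<in> \<Gamma>" "\<And>a b. a \<in> \<Gamma> \<Longrightarrow> b \<in> \<Gamma> \<Longrightarrow> a + b \<in> \<Gamma>" "\<And>a. a \<in> \<Gamma> \<Longrightarrow> - a \<in> \<Gamma>"
    and "\<Gamma> \<noteq> {0}" and nz: "y 0 \<noteq> 0"
    and br: "\<And>a b. a \<in> \<Gamma> \<Longrightarrow> b \<in> \<Gamma> \<Longrightarrow> bracket (y a) (y b) = scale (b - a) (y (a + b))"
  shows "\<exists>c. c \<noteq> 0 \<and> (\<forall>a\<in>\<Gamma>. \<exists>k. y a = scale k (L (c * a) 0)) \<and> y 0 = scale (1 / c) (L 0 0)"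
proof -
  have E: "y 0 * deriv (y a) = scale a (y a) + y a * deriv (y 0)" if "a \<in> \<Gamma>" for a
    using br[OF \<Gamma>(1) that] by (simp add: bracket_eq algebra_simps)
  have mult: "y a * y b = y 0 * y (a + b)" if "a \<in> \<Gamma>" "b \<in> \<Gamma>" for a b
    by (rule witt_subalgebra_mult[of \<Gamma>]) (simp_all add: \<Gamma> nz br that)
  have multiples: "of_int n * a \<in> \<Gamma>" if "a \<in> \<Gamma>" for n :: int and a
  proof -
    have nat: "of_nat m * a \<in> \<Gamma>" for m :: nat
      by (induction m) (auto simp: \<Gamma> that distrib_right)
    then show ?thesis
      using \<Gamma>(3)[OF nat] by (cases n rule: int_cases2) auto
  qed
  have main: "\<exists>b k. b \<noteq> 0 \<and> y 0 = scale (a / b) 1 \<and> y a = scale k (L b 0)"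
    if a: "a \<in> \<Gamma>" "a \<noteq> 0" for a
  proof -
    have "y (of_int i * a) * y (of_int j * a) = y (of_int 0 * a) * y (of_int (i + j) * a)" for i j :: int
      using mult[OF multiples[OF a(1)] multiples[OF a(1)], of i j] by (simp add: algebra_simps)
    from vec_ratio_monomial[of "\<lambda>i. y (of_int i * a)", OF this] nz
    obtain c b0 i b1 j where c: "c \<noteq> 0" and ratio: "L b0 i * y a = scale c (L b1 j * y 0)"
      by auto
    define t where "t = L 0 1"
    define u where "u = L b0 i"
    define v where "v = L b1 j"
    have uv: "u * y a = scale c (v * y 0)" using ratio by (simp add: u_def v_def)
    have nzs: "u \<noteq> 0" "v \<noteq> 0" by (simp_all add: u_def v_def L_nonzero)
    have du: "deriv u = u * (scale b0 1 + scale (of_nat i) t)"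
      and dv: "deriv v = v * (scale b1 1 + scale (of_nat j) t)"
      by (simp_all add: u_def v_def t_def deriv_L_factor)
    \<comment> \<open>The differentiated ratio relation. Combined with \<open>E\<close> it yields
      \<open>y 0 * (deriv v / v - deriv u / u) = a\<close>, stated below without
      denominators.\<close>
    have D: "u * deriv (y a) = scale c (v * deriv (y 0) + y 0 * deriv v) - y a * deriv u"
      using arg_cong[OF uv, of deriv] by (simp add: deriv_mult deriv_scale algebra_simps)
    have "scale a (scale c (v * y 0)) = u * scale a (y a)"
      by (simp add: scale_mult uv)
    also have "\<dots> = y 0 * (u * deriv (y a)) - (u * y a) * deriv (y 0)"
      using E[OF a(1)] by (simp add: algebra_simps)
    also have "\<dots> = scale c (y 0 * (y 0 * deriv v)) - y 0 * (y a * deriv u)"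
      unfolding D uv by (simp add: scale_mult scale_simps algebra_simps)
    also have "\<dots> = scale c (y 0 * (y 0 * deriv v)) -
        y 0 * ((u * y a) * (scale b0 1 + scale (of_nat i) t))"
      unfolding du by (simp add: mult_ac)
    also have "\<dots> = scale c (v * y 0 * (y 0 *
        ((scale b1 1 + scale (of_nat j) t) - (scale b0 1 + scale (of_nat i) t))))"
      unfolding uv dv by (simp add: scale_mult scale_minus right_diff_distrib mult_ac)
    also have "(scale b1 1 + scale (of_nat j) t) - (scale b0 1 + scale (of_nat i) t) =
        scale (b1 - b0) 1 + scale (of_nat j - of_nat i) t"
      by (rule poly_mapping_eqI) (simp add: lookup_add lookup_minus algebra_simps)
    finally have "scale c (v * y 0 * (y 0 * (scale (b1 - b0) 1 + scale (of_nat j - of_nat i) t) - scale a 1)) = 0"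
      by (simp add: scale_mult scale_minus scale_simps right_diff_distrib mult.commute[of a])
    then have lin: "y 0 * (scale (b1 - b0) 1 + scale (of_nat j - of_nat i) (L 0 1)) = scale a 1"
      using c nzs nz by (simp add: scale_eq_0 vec_mult_eq_0 t_def)
    have ij: "i = j" and b: "b1 - b0 \<noteq> 0" and y0: "y 0 = scale (a / (b1 - b0)) 1"
      using linear_in_t_unit[OF lin a(2)] by auto
    have "u * y a = u * scale (c * (a / (b1 - b0))) (L (b1 - b0) 0)"
      unfolding uv unfolding y0 u_def v_def ij by (simp add: scale_mult scale_simps L_mult)
    then have "y a = scale (c * (a / (b1 - b0))) (L (b1 - b0) 0)"
      using nzs(1) by (rule vec_mult_left_cancel[rotated])
    then show ?thesis using b y0 by blast
  qed
  obtain a where a: "a \<in> \<Gamma>" "a \<noteq> 0" using \<Gamma>(1) \<open>\<Gamma> \<noteq> {0}\<close> by auto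
  from main[OF a] obtain b where b: "b \<noteq> 0" "y 0 = scale (a / b) 1" by blast
  have scale_one: "r = r'" if "scale r 1 = scale r' 1" for r r'
    using arg_cong[OF that, of "\<lambda>x. Poly_Mapping.lookup x 0"] by simp
  \<comment> \<open>All nonzero \<open>d\<close> share the constant \<open>y 0\<close>, which fixes
    the quotient of \<open>d\<close> by its exponent \<open>b'\<close>.\<close>
  have "\<exists>k. y d = scale k (L (b / a * d) 0)" if d: "d \<in> \<Gamma>" for d
  proof (cases "d = 0")
    case True
    then show ?thesis using b(2) by (auto simp: L_0_0)
  next
    case False
    from main[OF d False] obtain b' k where *: "b' \<noteq> 0" "y 0 = scale (d / b') 1" "y d = scale k (L b' 0)"
      by blast
    have "a / b = d / b'" using b(2) *(2) by (intro scale_one) simp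
    then have "b' = b / a * d" using a b(1) *(1) by (simp add: field_simps)
    then show ?thesis using *(3) by blast
  qed
  then show ?thesis
    using a b by (intro exI[of _ "b / a"]) (auto simp: L_0_0)
qed

subsection \<open>Automorphisms fixing the elements \<open>L a 0\<close>\<close>

text \<open>The truncated \<open>i - 1\<close> is harmless at \<open>i = 0\<close>, where the factor
  \<open>of_nat (i - 1)\<close> vanishes.\<close>

lemma lookup_deriv:
  "Poly_Mapping.lookup (deriv x) (a, i) =
     a * Poly_Mapping.lookup x (a, i) + of_nat (i - 1) * Poly_Mapping.lookup x (a, i - 1)"
proof (induction x rule: vec_induct)
  case (L b j)
  show ?case
    unfolding deriv_L by (cases i) (auto simp: lookup_add L_def lookup_single when_def)
qed (simp_all add: deriv_scale deriv_add lookup_add algebra_simps)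

lemma keys_deriv:
  "Poly_Mapping.keys (deriv x) \<subseteq> Poly_Mapping.keys x \<union> (\<lambda>k. k + (0, 1)) ` Poly_Mapping.keys x"
proof (clarify, rule ccontr)
  fix a i
  assume *: "(a, i) \<in> Poly_Mapping.keys (deriv x)" "(a, i) \<notin> (\<lambda>k. k + (0, 1)) ` Poly_Mapping.keys x"
    "(a, i) \<notin> Poly_Mapping.keys x"
  have "of_nat (i - 1) * Poly_Mapping.lookup x (a, i - 1) = 0"
  proof (cases i)
    case (Suc j)
    have "(a, j) \<notin> Poly_Mapping.keys x"
    proof
      assume "(a, j) \<in> Poly_Mapping.keys x"
      then have "(a, j) + (0, 1) \<in> (\<lambda>k. k + (0, 1)) ` Poly_Mapping.keys x" by (rule imageI)
      then show False using *(2) Suc by simp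
    qed
    then show ?thesis using Suc by (simp add: in_keys_iff)
  qed simp
  then show False using *(1,3) by (simp add: in_keys_iff lookup_deriv)
qed

lemma deriv_eigenvector:
  assumes "deriv x = scale a x"
  shows "\<exists>d. x = scale d (L a 0)"
proof -
  have eq: "a * Poly_Mapping.lookup x (b, i) =
      b * Poly_Mapping.lookup x (b, i) + of_nat (i - 1) * Poly_Mapping.lookup x (b, i - 1)" for b i
    using arg_cong[OF assms, of "\<lambda>x. Poly_Mapping.lookup x (b, i)"] by (simp add: lookup_deriv)
  have other: "Poly_Mapping.lookup x (b, i) = 0" if "b \<noteq> a" for b i
  proof (induction i)
    case 0
    then show ?case using eq[of b 0] that by simp
  next
    case (Suc i)
    then show ?case using eq[of b "Suc i"] that by simp
  qed
  \<comment> \<open>At \<open>t^(i + 2)\<close> the terms with factor \<open>a\<close> cancel,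
    leaving \<open>i + 1\<close> times the coefficient of \<open>t^(i + 1)\<close>.\<close>
  have same: "Poly_Mapping.lookup x (a, Suc i) = 0" for i
    using eq[of a "Suc (Suc i)"] by (simp add: distrib_right del: of_nat_Suc)
  have "x = scale (Poly_Mapping.lookup x (a, 0)) (L a 0)"
  proof (rule poly_mapping_eqI)
    fix k :: "complex \<times> nat"
    obtain b i where k: "k = (b, i)" by (cases k)
    show "Poly_Mapping.lookup x k = Poly_Mapping.lookup (scale (Poly_Mapping.lookup x (a, 0)) (L a 0)) k"
      using other[of b i] same by (cases i) (auto simp: k L_def lookup_single when_def)
  qed
  then show ?thesis by blast
qed

text \<open>Squaring doubles the extreme heights, whereas \<open>deriv\<close> raises heights by at
  most 1 and never lowers the minimum. So all heights lie between 0 and 1; for large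
  \<open>s\<close> this leaves only \<open>1\<close> and \<open>t\<close>, whose coefficients are
  then compared.\<close>

lemma square_eq_deriv_cases:
  assumes g: "g * g = deriv g" and nz: "g \<noteq> 0"
  shows "g = L 0 1"
proof -
  have supp: "Poly_Mapping.keys g \<subseteq> {(0, 0), (0, 1)}"
  proof -
    have "\<forall>\<^sub>F s in at_top. fst k \<noteq> 0 \<longrightarrow> 1 < \<bar>height s k\<bar>" for k
      using eventually_height_large[of "fst k" 1 "snd k"] by (cases "fst k = 0") simp_all
    then have "\<forall>\<^sub>F s in at_top. \<forall>k\<in>Poly_Mapping.keys g. fst k \<noteq> 0 \<longrightarrow> 1 < \<bar>height s k\<bar>"
      by (intro eventually_ball_finite ballI finite_keys)
    moreover have "\<forall>\<^sub>F s in at_top. inj_on (height s) (Poly_Mapping.keys g)"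
      by (intro eventually_inj_on_height finite_keys)
    ultimately have "\<forall>\<^sub>F s in at_top. inj_on (height s) (Poly_Mapping.keys g) \<and>
        (\<forall>k\<in>Poly_Mapping.keys g. fst k \<noteq> 0 \<longrightarrow> 1 < \<bar>height s k\<bar>)"
      by eventually_elim blast
    then obtain s where inj: "inj_on (height s) (Poly_Mapping.keys g)"
      and large: "\<And>k. k \<in> Poly_Mapping.keys g \<Longrightarrow> fst k \<noteq> 0 \<Longrightarrow> 1 < \<bar>height s k\<bar>"
      by (auto dest!: eventually_happens)
    define G where "G = collapse s g"
    have G: "G \<noteq> 0" using inj nz by (simp add: G_def collapse_eq_0)
    have keys_G: "Poly_Mapping.keys G = height s ` Poly_Mapping.keys g"
      using inj by (simp add: G_def keys_collapse)
    have "Poly_Mapping.keys (G * G) \<subseteq> height s ` Poly_Mapping.keys (deriv g)"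
      using keys_collapse_subset[of s "deriv g"] by (simp add: G_def flip: g collapse_mult)
    also have "\<dots> \<subseteq> Poly_Mapping.keys G \<union> (\<lambda>r. r + 1) ` Poly_Mapping.keys G"
    proof -
      have "height s (k + (0, 1)) = height s k + 1" for k
        by (simp add: height_def)
      then have "height s ` (Poly_Mapping.keys g \<union> (\<lambda>k. k + (0, 1)) ` Poly_Mapping.keys g) =
          Poly_Mapping.keys G \<union> (\<lambda>r. r + 1) ` Poly_Mapping.keys G"
        by (simp only: image_Un image_image keys_G)
      then show ?thesis using image_mono[OF keys_deriv[of g], of "height s"] by simp
    qed
    finally have sub: "Poly_Mapping.keys (G * G) \<subseteq> Poly_Mapping.keys G \<union> (\<lambda>r. r + 1) ` Poly_Mapping.keys G" .
    have "top_exp G + top_exp G \<in> Poly_Mapping.keys (G * G)"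
      using top_exp_in_keys[of "G * G"] G by (simp add: top_exp_mult)
    then have top: "top_exp G \<le> 1"
      using sub exp_bounds(1)[of _ G] by force
    have "low_exp G + low_exp G \<in> Poly_Mapping.keys (G * G)"
      using low_exp_in_keys[of "G * G"] G by (simp add: low_exp_mult)
    then have low: "0 \<le> low_exp G"
      using sub exp_bounds(2)[of _ G] by force
    show ?thesis
    proof
      fix k assume k: "k \<in> Poly_Mapping.keys g"
      then have "0 \<le> height s k" "height s k \<le> 1"
        using top low exp_bounds[of "height s k" G] by (auto simp: keys_G)
      moreover from this have "fst k = 0" using large[OF k] by force
      ultimately show "k \<in> {(0, 0), (0, 1)}"
        by (cases k) (auto simp: height_def)
    qed
  qed
  define a where "a = Poly_Mapping.lookup g (0, 0)"
  define b where "b = Poly_Mapping.lookup g (0, 1)"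
  have g_eq: "g = scale a 1 + scale b (L 0 1)"
  proof (rule poly_mapping_eqI)
    fix k
    show "Poly_Mapping.lookup g k = Poly_Mapping.lookup (scale a 1 + scale b (L 0 1)) k"
      using supp by (cases "k \<in> Poly_Mapping.keys g")
        (auto simp: lookup_add lookup_single L_def when_def in_keys_iff a_def b_def simp flip: L_0_0)
  qed
  have sq: "g * g = scale (a * a) (L 0 0) + scale (2 * a * b) (L 0 1) + scale (b * b) (L 0 2)"
    unfolding g_eq L_0_0[symmetric] distrib_left distrib_right scale_mult L_mult
    by (rule poly_mapping_eqI) (simp add: lookup_add numeral_2_eq_2 algebra_simps)
  have d: "deriv g = scale b (L 0 2)"
    unfolding g_eq L_0_0[symmetric] deriv_add deriv_scale deriv_L by (simp add: scale_simps numeral_2_eq_2)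
  have "a * a = 0" "b * b = b"
    using arg_cong[OF g, of "\<lambda>x. Poly_Mapping.lookup x (0, 0)"]
      arg_cong[OF g, of "\<lambda>x. Poly_Mapping.lookup x (0, 2)"]
    unfolding sq d by (simp_all add: lookup_add L_def lookup_single when_def)
  moreover from this have "b \<noteq> 0" using nz g_eq by (auto simp: scale_simps)
  ultimately show ?thesis using g_eq by (simp add: scale_simps)
qed

text \<open>Linearity is required only on \<open>W \<Gamma>\<close>, since automorphisms are
  extensional and take the value \<open>undefined\<close> elsewhere.\<close>

lemma linear_eqI:
  assumes x: "x \<in> W \<Gamma>"
    and f: "\<And>x y. x \<in> W \<Gamma> \<Longrightarrow> y \<in> W \<Gamma> \<Longrightarrow> f (x + y) = f x + f y"
      "\<And>c x. x \<in> W \<Gamma> \<Longrightarrow> f (scale c x) = scale c (f x)"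
    and g: "\<And>x y. x \<in> W \<Gamma> \<Longrightarrow> y \<in> W \<Gamma> \<Longrightarrow> g (x + y) = g x + g y"
      "\<And>c x. x \<in> W \<Gamma> \<Longrightarrow> g (scale c x) = scale c (g x)"
    and L: "\<And>a i. a \<in> \<Gamma> \<Longrightarrow> f (L a i) = g (L a i)"
  shows "f x = g x"
proof -
  have "f x = lin_ext (\<lambda>a i. f (L a i)) x" by (rule lin_ext_eq_on[OF x]) (simp_all add: f)
  also have "\<dots> = lin_ext (\<lambda>a i. g (L a i)) x"
    unfolding lin_ext_def split_def using x by (intro sum.cong) (auto simp: W_def L)
  also have "\<dots> = g x" by (rule lin_ext_eq_on[OF x, symmetric]) (simp_all add: g)
  finally show ?thesis .
qed

text \<open>The right-hand side sees \<open>x\<close> only through \<open>L a 0 * x\<close>. This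
  turns a defect of linearity into an eigenvector of \<open>deriv\<close>.\<close>

lemma bracket_L_0: "bracket (L a 0) x = deriv (L a 0 * x) - scale (2 * a) (L a 0 * x)"
  by (rule poly_mapping_eqI)
     (simp add: bracket_eq deriv_mult deriv_L scale_simps scale_mult lookup_add lookup_minus
        mult.commute algebra_simps)

text \<open>The defect \<open>f (x\<^sup>a v) - x\<^sup>a f v\<close> is an eigenvector of \<open>\<partial>\<close> for \<open>2 a\<close>, that is a multiple of
  \<open>x\<^sup>2\<^sup>a\<close>; comparing the exponents in its cocycle identity for \<open>a\<close> and \<open>2 a\<close> shows that it vanishes.\<close>
lemma lie_hom_fixing_degree_0:
  assumes \<Gamma>: "0 \<in> \<Gamma>" "\<And>a b. a \<in> \<Gamma> \<Longrightarrow> b \<in> \<Gamma> \<Longrightarrow> a + b \<in> \<Gamma>" and "\<Gamma> \<noteq> {0}"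
    and add: "\<And>x y. x \<in> W \<Gamma> \<Longrightarrow> y \<in> W \<Gamma> \<Longrightarrow> f (x + y) = f x + f y"
    and scale: "\<And>c x. x \<in> W \<Gamma> \<Longrightarrow> f (scale c x) = scale c (f x)"
    and br: "\<And>x y. x \<in> W \<Gamma> \<Longrightarrow> y \<in> W \<Gamma> \<Longrightarrow> f (bracket x y) = bracket (f x) (f y)"
    and fixed: "\<And>a. a \<in> \<Gamma> \<Longrightarrow> f (L a 0) = L a 0" and nz: "f (L 0 1) \<noteq> 0"
    and x: "x \<in> W \<Gamma>"
  shows "f x = x"
proof -
  have closed: "L a 0 * v \<in> W \<Gamma>" if "a \<in> \<Gamma>" "v \<in> W \<Gamma>" for a v
  proof -
    have "lin_ext (\<lambda>b i. L (a + b) i) v = L a 0 * v"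
      by (induction v rule: vec_induct)
         (simp_all add: L_mult lin_ext_add lin_ext_scale scale_mult distrib_left)
    moreover have "lin_ext (\<lambda>b i. L (a + b) i) v \<in> W \<Gamma>"
      by (rule lin_ext_closed[OF _ that(2)]) (simp add: W_closed \<Gamma> that)
    ultimately show ?thesis by simp
  qed
  have diff: "f (v - w) = f v - f w" if "v \<in> W \<Gamma>" "w \<in> W \<Gamma>" for v w
  proof -
    have "v - w = v + scale (- 1) w" for v w :: vec
      by (rule poly_mapping_eqI) (simp add: lookup_add lookup_minus)
    then show ?thesis by (simp only: add scale W_closed that)
  qed
  \<comment> \<open>\<open>deriv\<close> is the bracket with \<open>L 0 0\<close>, which
    \<open>f\<close> fixes.\<close>
  have f_deriv: "f (deriv v) = deriv (f v)" if "v \<in> W \<Gamma>" for v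
  proof -
    have "bracket (L 0 0) w = deriv w" for w
      unfolding bracket_L_0 by (simp add: L_0_0 scale_simps)
    then show ?thesis
      using br[OF W_closed(4)[OF \<Gamma>(1), of 0] that] fixed[OF \<Gamma>(1)] by simp
  qed
  have defect: "\<exists>d. f (L a 0 * v) = L a 0 * f v + scale d (L (2 * a) 0)"
    if a: "a \<in> \<Gamma>" and v: "v \<in> W \<Gamma>" for a v
  proof -
    let ?d = "f (L a 0 * v) - L a 0 * f v"
    have "f (bracket (L a 0) v) = deriv (f (L a 0 * v)) - scale (2 * a) (f (L a 0 * v))"
      unfolding bracket_L_0
      by (simp add: diff f_deriv scale closed a v deriv_closed W_closed)
    moreover have "f (bracket (L a 0) v) = deriv (L a 0 * f v) - scale (2 * a) (L a 0 * f v)"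
      using br[OF W_closed(4)[OF a, of 0] v] by (simp only: fixed[OF a] bracket_L_0[of a "f v"])
    moreover have "deriv (f (L a 0 * v)) = deriv ?d + deriv (L a 0 * f v)"
      by (simp flip: deriv_add)
    ultimately have "deriv ?d = scale (2 * a) ?d"
      by (simp add: scale_minus algebra_simps)
    then obtain d where "?d = scale d (L (2 * a) 0)"
      using deriv_eigenvector by blast
    then have "f (L a 0 * v) = L a 0 * f v + scale d (L (2 * a) 0)"
      by (simp add: algebra_simps)
    then show ?thesis by blast
  qed
  have linear: "f (L a 0 * v) = L a 0 * f v" if a: "a \<in> \<Gamma>" and v: "v \<in> W \<Gamma>" for a v
  proof (cases "a = 0")
    case False
    obtain d where d: "f (L a 0 * v) = L a 0 * f v + scale d (L (2 * a) 0)"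
      using defect[OF a v] by blast
    obtain d' where d': "f (L a 0 * (L a 0 * v)) = L a 0 * f (L a 0 * v) + scale d' (L (2 * a) 0)"
      using defect[OF a closed[OF a v]] by blast
    obtain d'' where d'': "f (L (a + a) 0 * v) = L (a + a) 0 * f v + scale d'' (L (2 * (a + a)) 0)"
      using defect[OF \<Gamma>(2)[OF a a] v] by blast
    have sq: "L (a + a) 0 = L a 0 * L a 0" by (simp add: L_mult)
    \<comment> \<open>The image of \<open>x^(2 a) v\<close> is computed in one step and in two. The
      coefficient of \<open>x^(3 a)\<close> isolates \<open>d\<close>, as \<open>3 a\<close> differs
      from \<open>2 a\<close> and \<open>4 a\<close>.\<close>
    have "scale d'' (L (2 * (a + a)) 0) = scale d (L a 0 * L (2 * a) 0) + scale d' (L (2 * a) 0)"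
      using d' d'' unfolding d sq by (simp add: mult.assoc distrib_left scale_mult)
    then have "Poly_Mapping.lookup (scale d'' (L (2 * (a + a)) 0)) (a + 2 * a, 0) =
        Poly_Mapping.lookup (scale d (L (a + 2 * a) 0) + scale d' (L (2 * a) 0)) (a + 2 * a, 0)"
      by (simp add: L_mult)
    then have "d = 0"
      using False by (simp add: lookup_add L_def lookup_single when_def)
    then show ?thesis using d by (simp add: scale_simps)
  qed (simp add: L_0_0)
  define g where "g = f (L 0 1)"
  obtain a where a: "a \<in> \<Gamma>" "a \<noteq> 0" using \<Gamma>(1) \<open>\<Gamma> \<noteq> {0}\<close> by auto
  have L_factor: "L b i = L b 0 * L 0 i" for b i by (simp add: L_mult)
  have f_L2: "f (L 0 2) = deriv g"
    using f_deriv[OF W_closed(4)[OF \<Gamma>(1), of 1]]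
    by (simp add: deriv_L scale_simps g_def numeral_2_eq_2)
  have f_La1: "f (L a 1) = L a 0 * g"
    unfolding g_def L_factor[of a 1] by (intro linear a W_closed \<Gamma>)
  have f_La2: "f (L a 2) = L a 0 * deriv g"
    unfolding f_L2[symmetric] L_factor[of a 2] by (intro linear a W_closed \<Gamma>)
  \<comment> \<open>The bracket of \<open>L a 1\<close> with \<open>L 0 1\<close> is
    \<open>- a\<close> times \<open>L a 2\<close>; after cancelling \<open>- a\<close> and
    \<open>x^a\<close>, its image is the equation for \<open>g\<close>.\<close>
  have "scale (- a) (L a 0 * deriv g) = f (bracket (L a 1) (L 0 1))"
    by (simp add: bracket_L scale_simps scale W_closed a f_La2 numeral_2_eq_2[symmetric])
  also have "\<dots> = bracket (L a 0 * g) g"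
    by (simp only: br W_closed a \<Gamma> f_La1 g_def)
  also have "\<dots> = scale (- a) (L a 0 * (g * g))"
    by (rule poly_mapping_eqI)
       (simp add: bracket_eq deriv_mult deriv_L scale_simps scale_mult algebra_simps lookup_minus lookup_add)
  finally have "scale (- a) (L a 0 * (g * g - deriv g)) = 0"
    by (simp add: right_diff_distrib scale_minus)
  then have "g * g = deriv g"
    using a by (simp add: scale_eq_0 vec_mult_eq_0 L_nonzero)
  then have g: "f (L 0 1) = L 0 1"
    using square_eq_deriv_cases[of g] nz unfolding g_def by blast
  \<comment> \<open>For \<open>i > 0\<close>, \<open>t^(i + 1)\<close> is \<open>deriv\<close> of
    \<open>t^i\<close> divided by \<open>i\<close>; the start \<open>t\<close> itself is
    \<open>g\<close>.\<close>
  have L0: "f (L 0 i) = L 0 i" for i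
  proof (induction i)
    case (Suc i)
    show ?case
    proof (cases "i = 0")
      case False
      have "scale (of_nat i) (f (L 0 (Suc i))) = f (deriv (L 0 i))"
        by (simp add: deriv_L scale_simps scale W_closed \<Gamma>)
      also have "\<dots> = deriv (f (L 0 i))"
        by (intro f_deriv W_closed \<Gamma>)
      also have "\<dots> = scale (of_nat i) (L 0 (Suc i))"
        by (simp add: Suc deriv_L scale_simps)
      finally have "scale (of_nat i) (f (L 0 (Suc i)) - L 0 (Suc i)) = 0"
        by (simp add: scale_minus)
      then show ?thesis using False by (simp add: scale_eq_0)
    qed (use g in simp)
  qed (simp add: fixed \<Gamma>)
  show ?thesis
  proof (rule linear_eqI[OF x])
    fix b i assume b: "b \<in> \<Gamma>"
    show "f (L b i) = L b i"
      unfolding L_factor[of b i] by (simp add: linear b W_closed \<Gamma> L0)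
  qed (simp_all add: add scale)
qed

subsection \<open>The group of automorphisms\<close>

lemma subgroup_complex_add:
  assumes "subgroup \<Gamma> complex_add"
  shows "0 \<in> \<Gamma>" "\<And>a b. a \<in> \<Gamma> \<Longrightarrow> b \<in> \<Gamma> \<Longrightarrow> a + b \<in> \<Gamma>" "\<And>a. a \<in> \<Gamma> \<Longrightarrow> - a \<in> \<Gamma>"
proof -
  have group: "group complex_add"
    by (rule groupI) (auto simp: complex_add_def intro: exI[of _ "- x" for x])
  show "0 \<in> \<Gamma>" "\<And>a b. a \<in> \<Gamma> \<Longrightarrow> b \<in> \<Gamma> \<Longrightarrow> a + b \<in> \<Gamma>"
    using subgroup.one_closed[OF assms] subgroup.m_closed[OF assms] by (simp_all add: complex_add_def)
  show "- a \<in> \<Gamma>" if "a \<in> \<Gamma>" for a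
  proof -
    have "inv\<^bsub>complex_add\<^esub> a = - a"
      by (rule group.inv_equality[OF group]) (simp_all add: complex_add_def)
    then show ?thesis using subgroup.m_inv_closed[OF assms that] by simp
  qed
qed

lemma characters_iff:
  "\<tau> \<in> characters \<Gamma> \<longleftrightarrow> \<tau> \<in> extensional \<Gamma> \<and> (\<forall>a\<in>\<Gamma>. \<tau> a \<noteq> 0) \<and>
     (\<forall>a\<in>\<Gamma>. \<forall>b\<in>\<Gamma>. \<tau> (a + b) = \<tau> a * \<tau> b)"
  by (auto simp: characters_def hom_def complex_add_def complex_units_def)

lemma scalings_iff:
  "c \<in> scalings \<Gamma> \<longleftrightarrow> c \<noteq> 0 \<and> (\<forall>a\<in>\<Gamma>. c * a \<in> \<Gamma> \<and> a / c \<in> \<Gamma>)"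
proof (cases "c = 0")
  case False
  then have "a \<in> (*) c ` \<Gamma> \<longleftrightarrow> a / c \<in> \<Gamma>" for a
    by (auto simp: image_iff intro: bexI[of _ "a / c"])
  then show ?thesis using False by (auto simp: scalings_def)
qed (simp add: scalings_def)

section \<open>Composition and inverses of Lie algebra automorphisms\<close>

lemma lie_autoD:
  assumes "f \<in> lie_auto \<Gamma>"
  shows "f \<in> Bij (W \<Gamma>)" "x \<in> W \<Gamma> \<Longrightarrow> f x \<in> W \<Gamma>" "inj_on f (W \<Gamma>)"
    and "x \<in> W \<Gamma> \<Longrightarrow> y \<in> W \<Gamma> \<Longrightarrow> f (x + y) = f x + f y"
    and "x \<in> W \<Gamma> \<Longrightarrow> f (scale c x) = scale c (f x)"
    and "x \<in> W \<Gamma> \<Longrightarrow> y \<in> W \<Gamma> \<Longrightarrow> f (bracket x y) = bracket (f x) (f y)"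
  using assms by (auto simp: lie_auto_def Bij_def bij_betw_def)

lemma lie_auto_eq_0:
  assumes "f \<in> lie_auto \<Gamma>" "x \<in> W \<Gamma>"
  shows "f x = 0 \<longleftrightarrow> x = 0"
proof -
  have "f 0 = 0"
    using lie_autoD(5)[OF assms(1) W_closed(1), of 0] by (simp add: scale_simps)
  then show ?thesis
    using inj_onD[OF lie_autoD(3)[OF assms(1)], of x 0] assms(2) W_closed(1) by auto
qed

lemma inv_lie_auto:
  assumes \<Gamma>: "subgroup \<Gamma> complex_add" and f: "f \<in> lie_auto \<Gamma>"
  shows "restrict (inv_into (W \<Gamma>) f) (W \<Gamma>) \<in> lie_auto \<Gamma>"
proof -
  let ?g = "inv_into (W \<Gamma>) f"
  have bij: "bij_betw f (W \<Gamma>) (W \<Gamma>)" using lie_autoD(1)[OF f] by (simp add: Bij_def)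
  have g: "?g x \<in> W \<Gamma>" "f (?g x) = x" if "x \<in> W \<Gamma>" for x
    using bij that by (auto simp: bij_betw_def inv_into_into f_inv_into_f)
  have eqI: "?g x = y" if "f y = x" "y \<in> W \<Gamma>" for x y
    using bij that by (auto simp: bij_betw_def)
  have "?g (x + y) = ?g x + ?g y" "?g (scale c x) = scale c (?g x)"
    "?g (bracket x y) = bracket (?g x) (?g y)" if "x \<in> W \<Gamma>" "y \<in> W \<Gamma>" for x y c
    using that by (intro eqI; simp add: lie_autoD[OF f] g W_closed bracket_closed[OF \<Gamma>])+
  then show ?thesis
    using lie_autoD(1)[OF f] restrict_inv_into_Bij
    by (simp add: lie_auto_def W_closed bracket_closed[OF \<Gamma>])
qed

lemma compose_lie_auto:
  assumes \<Gamma>: "subgroup \<Gamma> complex_add" and f: "f \<in> lie_auto \<Gamma>" and g: "g \<in> lie_auto \<Gamma>"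
  shows "compose (W \<Gamma>) f g \<in> lie_auto \<Gamma>"
  using compose_Bij[OF lie_autoD(1)[OF f] lie_autoD(1)[OF g]]
  by (simp add: lie_auto_def compose_eq lie_autoD[OF f] lie_autoD[OF g] W_closed bracket_closed[OF \<Gamma>])

lemma group_LieAutoGroup:
  assumes \<Gamma>: "subgroup \<Gamma> complex_add"
  shows "group (LieAutoGroup \<Gamma>)"
proof -
  have "subgroup (lie_auto \<Gamma>) (BijGroup (W \<Gamma>))"
  proof (rule subgroup.intro)
    show "lie_auto \<Gamma> \<subseteq> carrier (BijGroup (W \<Gamma>))"
      by (auto simp: BijGroup_def lie_auto_def)
    show "f \<otimes>\<^bsub>BijGroup (W \<Gamma>)\<^esub> g \<in> lie_auto \<Gamma>" if "f \<in> lie_auto \<Gamma>" "g \<in> lie_auto \<Gamma>" for f g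
      using that lie_autoD(1) compose_lie_auto[OF \<Gamma>] by (simp add: BijGroup_def)
    show "\<one>\<^bsub>BijGroup (W \<Gamma>)\<^esub> \<in> lie_auto \<Gamma>"
      by (simp add: BijGroup_def lie_auto_def id_Bij W_closed bracket_closed[OF \<Gamma>])
    show "inv\<^bsub>BijGroup (W \<Gamma>)\<^esub> f \<in> lie_auto \<Gamma>" if "f \<in> lie_auto \<Gamma>" for f
      using inv_BijGroup[OF lie_autoD(1)[OF that]] inv_lie_auto[OF \<Gamma> that] by simp
  qed
  then show ?thesis
    unfolding LieAutoGroup_def by (rule subgroup.subgroup_is_group[OF _ group_BijGroup])
qed

lemma mult_LieAutoGroup:
  "f \<in> lie_auto \<Gamma> \<Longrightarrow> g \<in> lie_auto \<Gamma> \<Longrightarrow> f \<otimes>\<^bsub>LieAutoGroup \<Gamma>\<^esub> g = compose (W \<Gamma>) f g"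
  by (simp add: LieAutoGroup_def BijGroup_def lie_autoD(1))

section \<open>The group of pairs of a character and a scaling\<close>

lemma semidirect_simps:
  "carrier (semidirect \<Gamma>) = characters \<Gamma> \<times> scalings \<Gamma>"
  "(\<tau>, c) \<otimes>\<^bsub>semidirect \<Gamma>\<^esub> (\<tau>', c') = (\<lambda>a\<in>\<Gamma>. \<tau> (c' * a) * \<tau>' a, c * c')"
  "\<one>\<^bsub>semidirect \<Gamma>\<^esub> = (\<lambda>a\<in>\<Gamma>. 1, 1)"
  by (simp_all add: semidirect_def)

lemma group_semidirect:
  assumes "subgroup \<Gamma> complex_add"
  shows "group (semidirect \<Gamma>)"
proof (rule groupI)
  note add_closed = subgroup_complex_add(2)[OF assms]
  show "\<one>\<^bsub>semidirect \<Gamma>\<^esub> \<in> carrier (semidirect \<Gamma>)"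
    by (simp add: semidirect_simps characters_iff scalings_iff add_closed)
  fix p assume p: "p \<in> carrier (semidirect \<Gamma>)"
  obtain \<tau> c where p_eq: "p = (\<tau>, c)" by (cases p)
  have \<tau>: "\<tau> \<in> extensional \<Gamma>" "\<And>a. a \<in> \<Gamma> \<Longrightarrow> \<tau> a \<noteq> 0" "\<And>a b. a \<in> \<Gamma> \<Longrightarrow> b \<in> \<Gamma> \<Longrightarrow> \<tau> (a + b) = \<tau> a * \<tau> b"
    and c: "c \<noteq> 0" "\<And>a. a \<in> \<Gamma> \<Longrightarrow> c * a \<in> \<Gamma>" "\<And>a. a \<in> \<Gamma> \<Longrightarrow> a / c \<in> \<Gamma>"
    using p by (auto simp: p_eq semidirect_simps characters_iff scalings_iff)
  show "\<one>\<^bsub>semidirect \<Gamma>\<^esub> \<otimes>\<^bsub>semidirect \<Gamma>\<^esub> p = p"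
    using \<tau>(1) by (auto simp: p_eq semidirect_simps c intro!: extensionalityI[of _ \<Gamma>])
  \<comment> \<open>A left inverse with character \<open>\<sigma>\<close> must satisfy
    \<open>\<sigma> (c * a) * \<tau> a = 1\<close>, which dictates this formula.\<close>
  let ?r = "(\<lambda>a\<in>\<Gamma>. 1 / \<tau> (a / c), 1 / c)"
  have "?r \<in> carrier (semidirect \<Gamma>)"
    by (simp add: semidirect_simps characters_iff scalings_iff c c(2)[unfolded mult.commute[of c]] \<tau>
        add_closed add_divide_distrib)
  moreover have "?r \<otimes>\<^bsub>semidirect \<Gamma>\<^esub> p = \<one>\<^bsub>semidirect \<Gamma>\<^esub>"
    by (auto simp: p_eq semidirect_simps c \<tau> intro!: restrict_ext)
  ultimately show "\<exists>r\<in>carrier (semidirect \<Gamma>). r \<otimes>\<^bsub>semidirect \<Gamma>\<^esub> p = \<one>\<^bsub>semidirect \<Gamma>\<^esub>"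
    by blast
  fix q assume q: "q \<in> carrier (semidirect \<Gamma>)"
  obtain \<tau>' c' where q_eq: "q = (\<tau>', c')" by (cases q)
  have \<tau>': "\<And>a. a \<in> \<Gamma> \<Longrightarrow> \<tau>' a \<noteq> 0" "\<And>a b. a \<in> \<Gamma> \<Longrightarrow> b \<in> \<Gamma> \<Longrightarrow> \<tau>' (a + b) = \<tau>' a * \<tau>' b"
    and c': "c' \<noteq> 0" "\<And>a. a \<in> \<Gamma> \<Longrightarrow> c' * a \<in> \<Gamma>" "\<And>a. a \<in> \<Gamma> \<Longrightarrow> a / c' \<in> \<Gamma>"
    using q by (auto simp: q_eq semidirect_simps characters_iff scalings_iff)
  have "a / (c * c') \<in> \<Gamma>" "c * c' * a \<in> \<Gamma>" if "a \<in> \<Gamma>" for a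
    using c'(3)[OF c(3)[OF that]] c(2)[OF c'(2)[OF that]] by (simp_all add: mult.assoc)
  then show "p \<otimes>\<^bsub>semidirect \<Gamma>\<^esub> q \<in> carrier (semidirect \<Gamma>)"
    by (auto simp: p_eq q_eq semidirect_simps characters_iff scalings_iff \<tau> c \<tau>' c' add_closed distrib_left)
  show "p \<otimes>\<^bsub>semidirect \<Gamma>\<^esub> q \<otimes>\<^bsub>semidirect \<Gamma>\<^esub> r = p \<otimes>\<^bsub>semidirect \<Gamma>\<^esub> (q \<otimes>\<^bsub>semidirect \<Gamma>\<^esub> r)"
    if "r \<in> carrier (semidirect \<Gamma>)" for r
    using that by (cases r) (auto simp: p_eq q_eq semidirect_simps scalings_iff mult.assoc intro!: restrict_ext)
qed

lemma scale_L_cancel: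
  assumes "scale r (L a i) = scale r' (L a i)" shows "r = r'"
  using arg_cong[OF assms, of "\<lambda>x. Poly_Mapping.lookup x (a, i)"] by (simp add: L_def)

section \<open>The maps \<open>phi \<Gamma> p\<close> as automorphisms\<close>

lemma phi_linear:
  assumes "x \<in> W \<Gamma>"
  shows "y \<in> W \<Gamma> \<Longrightarrow> phi \<Gamma> p (x + y) = phi \<Gamma> p x + phi \<Gamma> p y"
    and "phi \<Gamma> p (scale d x) = scale d (phi \<Gamma> p x)"
  using assms by (cases p; simp add: phi_def W_closed lin_ext_add lin_ext_scale)+

lemma phi_closed:
  assumes "c \<in> scalings \<Gamma>" "x \<in> W \<Gamma>"
  shows "phi \<Gamma> (\<tau>, c) x \<in> W \<Gamma>"
  using assms by (simp add: phi_def) (rule lin_ext_closed; simp add: W_closed scalings_iff)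

text \<open>The powers of \<open>c\<close> from both arguments multiply to the one prescribed in
  degree \<open>i + j + 1\<close>. In degree \<open>i + j\<close> a factor \<open>c\<close> is
  missing, and it comes from \<open>c * b - c * a\<close>.\<close>

lemma phi_bracket:
  assumes \<Gamma>: "subgroup \<Gamma> complex_add" and p: "p \<in> carrier (semidirect \<Gamma>)"
    and x: "x \<in> W \<Gamma>" and y: "y \<in> W \<Gamma>"
  shows "phi \<Gamma> p (bracket x y) = bracket (phi \<Gamma> p x) (phi \<Gamma> p y)"
proof -
  obtain \<tau> c where p_eq: "p = (\<tau>, c)" by (cases p)
  have \<tau>: "\<And>a b. a \<in> \<Gamma> \<Longrightarrow> b \<in> \<Gamma> \<Longrightarrow> \<tau> (a + b) = \<tau> a * \<tau> b" and c: "c \<noteq> 0"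
    using p by (auto simp: p_eq semidirect_simps characters_iff scalings_iff)
  note simps = bracket_bilinear bracket_closed[OF \<Gamma>] W_closed phi_linear
  show ?thesis
  proof (rule linear_eqI[OF x])
    fix a i assume a: "a \<in> \<Gamma>"
    show "phi \<Gamma> p (bracket (L a i) y) = bracket (phi \<Gamma> p (L a i)) (phi \<Gamma> p y)"
    proof (rule linear_eqI[OF y])
      fix b j assume b: "b \<in> \<Gamma>"
      have powi1: "c powi (- int (i + j) - 1) = c * (c powi (- int i - 1) * c powi (- int j - 1))"
      proof -
        have "c powi (- int (i + j) - 1) = c powi (1 + ((- int i - 1) + (- int j - 1)))"
          by (intro arg_cong2[of _ _ _ _ "(powi)"]) simp_all
        then show ?thesis by (simp only: power_int_add[OF disjI1[OF c]] power_int_1_right)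
      qed
      have powi2: "c powi (- int (i + j + 1) - 1) = c powi (- int i - 1) * c powi (- int j - 1)"
      proof -
        have "c powi (- int (i + j + 1) - 1) = c powi ((- int i - 1) + (- int j - 1))"
          by (intro arg_cong2[of _ _ _ _ "(powi)"]) simp_all
        then show ?thesis by (simp only: power_int_add[OF disjI1[OF c]])
      qed
      have ab: "a + b \<in> \<Gamma>" using subgroup_complex_add(2)[OF \<Gamma> a b] .
      have "phi \<Gamma> p (bracket (L a i) (L b j)) =
          scale (b - a) (phi \<Gamma> p (L (a + b) (i + j))) +
          scale (of_nat j - of_nat i) (phi \<Gamma> p (L (a + b) (i + j + 1)))"
        unfolding bracket_L by (simp only: phi_linear W_closed ab)
      also have "\<dots> = bracket (phi \<Gamma> p (L a i)) (phi \<Gamma> p (L b j))"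
        unfolding p_eq phi_L[OF ab] phi_L[OF a] phi_L[OF b] bracket_bilinear bracket_L powi1 powi2 \<tau>[OF a b]
        by (rule poly_mapping_eqI) (simp add: lookup_add distrib_left[symmetric] algebra_simps)
      finally show "phi \<Gamma> p (bracket (L a i) (L b j)) = bracket (phi \<Gamma> p (L a i)) (phi \<Gamma> p (L b j))" .
    qed (simp_all add: simps a)
  qed (simp_all add: simps y)
qed

text \<open>\<open>q\<close> moves the index \<open>a\<close> to \<open>c' * a\<close> before
  \<open>p\<close> evaluates its character there; this is the twist in the product.\<close>

lemma phi_mult:
  assumes p: "p \<in> carrier (semidirect \<Gamma>)" and q: "q \<in> carrier (semidirect \<Gamma>)"
    and x: "x \<in> W \<Gamma>"
  shows "phi \<Gamma> (p \<otimes>\<^bsub>semidirect \<Gamma>\<^esub> q) x = phi \<Gamma> p (phi \<Gamma> q x)"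
proof -
  obtain \<tau> c where p_eq: "p = (\<tau>, c)" by (cases p)
  obtain \<tau>' c' where q_eq: "q = (\<tau>', c')" by (cases q)
  have c': "c' \<in> scalings \<Gamma>" using q by (simp add: q_eq semidirect_simps)
  show ?thesis
  proof (rule linear_eqI[OF x])
    fix a i assume a: "a \<in> \<Gamma>"
    then have "c' * a \<in> \<Gamma>" using c' by (simp add: scalings_iff)
    then show "phi \<Gamma> (p \<otimes>\<^bsub>semidirect \<Gamma>\<^esub> q) (L a i) = phi \<Gamma> p (phi \<Gamma> q (L a i))"
      using a by (simp add: p_eq q_eq semidirect_simps phi_L phi_linear W_closed scale_simps
          power_int_mult_distrib mult_ac)
  qed (simp_all add: phi_linear q_eq phi_closed[OF c'])
qed

lemma phi_one: "x \<in> W \<Gamma> \<Longrightarrow> phi \<Gamma> \<one>\<^bsub>semidirect \<Gamma>\<^esub> x = x"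
  by (rule linear_eqI[of x \<Gamma>]) (simp_all add: phi_linear semidirect_simps phi_L scale_simps)

lemma phi_inverse:
  assumes \<Gamma>: "subgroup \<Gamma> complex_add" and p: "p \<in> carrier (semidirect \<Gamma>)" and x: "x \<in> W \<Gamma>"
  shows "phi \<Gamma> p (phi \<Gamma> (inv\<^bsub>semidirect \<Gamma>\<^esub> p) x) = x" "phi \<Gamma> (inv\<^bsub>semidirect \<Gamma>\<^esub> p) (phi \<Gamma> p x) = x"
proof -
  interpret group "semidirect \<Gamma>" by (rule group_semidirect[OF \<Gamma>])
  show "phi \<Gamma> p (phi \<Gamma> (inv\<^bsub>semidirect \<Gamma>\<^esub> p) x) = x" "phi \<Gamma> (inv\<^bsub>semidirect \<Gamma>\<^esub> p) (phi \<Gamma> p x) = x"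
    using phi_mult[OF p inv_closed[OF p] x] phi_mult[OF inv_closed[OF p] p x] p phi_one[OF x] by simp_all
qed

lemma phi_lie_auto:
  assumes \<Gamma>: "subgroup \<Gamma> complex_add" and p: "p \<in> carrier (semidirect \<Gamma>)"
  shows "phi \<Gamma> p \<in> lie_auto \<Gamma>"
proof -
  have closed: "phi \<Gamma> q x \<in> W \<Gamma>" if "q \<in> carrier (semidirect \<Gamma>)" "x \<in> W \<Gamma>" for q x
    using that by (cases q) (auto simp: semidirect_simps phi_closed)
  have inv: "inv\<^bsub>semidirect \<Gamma>\<^esub> p \<in> carrier (semidirect \<Gamma>)"
    using group.inv_closed[OF group_semidirect[OF \<Gamma>] p] .
  have "bij_betw (phi \<Gamma> p) (W \<Gamma>) (W \<Gamma>)"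
    by (rule bij_betw_byWitness[where f' = "phi \<Gamma> (inv\<^bsub>semidirect \<Gamma>\<^esub> p)"])
       (auto simp: phi_inverse[OF \<Gamma> p] closed p inv)
  moreover have "phi \<Gamma> p \<in> extensional (W \<Gamma>)"
    by (cases p) (simp add: phi_def)
  ultimately show ?thesis
    by (simp add: lie_auto_def Bij_def phi_linear phi_bracket[OF \<Gamma> p])
qed

text \<open>For nonzero \<open>a\<close> the index of the image of \<open>L a 0\<close> reveals
  \<open>c\<close>; the coefficients then reveal the character.\<close>

lemma phi_inj:
  assumes \<Gamma>: "subgroup \<Gamma> complex_add" "\<Gamma> \<noteq> {0}"
  shows "inj_on (phi \<Gamma>) (carrier (semidirect \<Gamma>))"
proof (rule inj_onI)
  fix p q assume p: "p \<in> carrier (semidirect \<Gamma>)" and q: "q \<in> carrier (semidirect \<Gamma>)"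
    and eq: "phi \<Gamma> p = phi \<Gamma> q"
  obtain \<tau> c where p_eq: "p = (\<tau>, c)" by (cases p)
  obtain \<tau>' c' where q_eq: "q = (\<tau>', c')" by (cases q)
  have \<tau>: "\<tau> \<in> extensional \<Gamma>" "\<And>a. a \<in> \<Gamma> \<Longrightarrow> \<tau> a \<noteq> 0" "c \<noteq> 0"
    and \<tau>': "\<tau>' \<in> extensional \<Gamma>"
    using p q by (auto simp: p_eq q_eq semidirect_simps characters_iff scalings_iff)
  have L_eq: "scale (\<tau> a / c) (L (c * a) 0) = scale (\<tau>' a / c') (L (c' * a) 0)" if "a \<in> \<Gamma>" for a
    using fun_cong[OF eq, of "L a 0"] that by (simp add: p_eq q_eq phi_L power_int_minus divide_inverse)
  have coeffs: "\<tau> a / c = (if c * a = c' * a then \<tau>' a / c' else 0)" if "a \<in> \<Gamma>" for a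
    using arg_cong[OF L_eq[OF that], of "\<lambda>x. Poly_Mapping.lookup x (c * a, 0)"]
    by (auto simp: L_def lookup_single when_def)
  obtain a where a: "a \<in> \<Gamma>" "a \<noteq> 0"
    using subgroup_complex_add(1)[OF \<Gamma>(1)] \<Gamma>(2) by auto
  have c: "c = c'" using coeffs[OF a(1)] \<tau>(2)[OF a(1)] \<tau>(3) a(2) by (auto split: if_splits)
  have "\<tau> a = \<tau>' a" if "a \<in> \<Gamma>" for a
    using coeffs[OF that] \<tau>(3) c by simp
  then show "p = q"
    using extensionalityI[OF \<tau>(1) \<tau>'] by (simp add: p_eq q_eq c)
qed

text \<open>The elements \<open>L a 0\<close> span a Witt type subalgebra, so
  \<open>witt_subalgebra_form\<close> applies to their images. That these lie in
  \<open>W \<Gamma>\<close> puts \<open>c * a\<close> into \<open>\<Gamma>\<close>.\<close>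

lemma lie_auto_degree_0:
  assumes \<Gamma>: "subgroup \<Gamma> complex_add" "\<Gamma> \<noteq> {0}" and f: "f \<in> lie_auto \<Gamma>"
  shows "\<exists>c. c \<noteq> 0 \<and> (\<forall>a\<in>\<Gamma>. \<exists>k. f (L a 0) = scale k (L (c * a) 0)) \<and>
           f (L 0 0) = scale (1 / c) (L 0 0) \<and> (\<forall>a\<in>\<Gamma>. c * a \<in> \<Gamma>)"
proof -
  note closed = subgroup_complex_add[OF \<Gamma>(1)]
  have nz: "f (L a 0) \<noteq> 0" if "a \<in> \<Gamma>" for a
    using lie_auto_eq_0[OF f W_closed(4)[OF that]] L_nonzero by simp
  have "\<exists>c. c \<noteq> 0 \<and> (\<forall>a\<in>\<Gamma>. \<exists>k. f (L a 0) = scale k (L (c * a) 0)) \<and> f (L 0 0) = scale (1 / c) (L 0 0)"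
  proof (rule witt_subalgebra_form)
    fix a b assume ab: "a \<in> \<Gamma>" "b \<in> \<Gamma>"
    show "bracket (f (L a 0)) (f (L b 0)) = scale (b - a) (f (L (a + b) 0))"
      using lie_autoD(6)[OF f W_closed(4)[OF ab(1)] W_closed(4)[OF ab(2)], of 0 0]
      by (simp add: bracket_L scale_simps lie_autoD(5)[OF f] W_closed ab closed)
  qed (use closed nz \<Gamma>(2) in auto)
  then obtain c where c: "c \<noteq> 0" "\<And>a. a \<in> \<Gamma> \<Longrightarrow> \<exists>k. f (L a 0) = scale k (L (c * a) 0)"
    "f (L 0 0) = scale (1 / c) (L 0 0)"
    by blast
  have "c * a \<in> \<Gamma>" if a: "a \<in> \<Gamma>" for a
  proof -
    obtain k where k: "f (L a 0) = scale k (L (c * a) 0)" using c(2)[OF a] by blast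
    then have "k \<noteq> 0" using nz[OF a] by (auto simp: scale_simps)
    moreover have "f (L a 0) \<in> W \<Gamma>" by (intro lie_autoD(2)[OF f] W_closed a)
    ultimately show ?thesis
      unfolding k W_def by (auto simp: L_def in_keys_iff lookup_single when_def split: if_splits)
  qed
  then show ?thesis using c by blast
qed

lemma lie_auto_is_phi:
  assumes \<Gamma>: "subgroup \<Gamma> complex_add" "\<Gamma> \<noteq> {0}" and f: "f \<in> lie_auto \<Gamma>"
  shows "f \<in> phi \<Gamma> ` carrier (semidirect \<Gamma>)"
proof -
  note closed = subgroup_complex_add[OF \<Gamma>(1)]
  have nz: "f (L a 0) \<noteq> 0" if "a \<in> \<Gamma>" for a
    using lie_auto_eq_0[OF f W_closed(4)[OF that]] L_nonzero by simp
  obtain c where c: "c \<noteq> 0" "\<And>a. a \<in> \<Gamma> \<Longrightarrow> \<exists>k. f (L a 0) = scale k (L (c * a) 0)"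
    "f (L 0 0) = scale (1 / c) (L 0 0)" "\<And>a. a \<in> \<Gamma> \<Longrightarrow> c * a \<in> \<Gamma>"
    using lie_auto_degree_0[OF \<Gamma> f] by blast
  let ?g = "restrict (inv_into (W \<Gamma>) f) (W \<Gamma>)"
  obtain d where d: "d \<noteq> 0" "?g (L 0 0) = scale (1 / d) (L 0 0)" "\<And>a. a \<in> \<Gamma> \<Longrightarrow> d * a \<in> \<Gamma>"
    using lie_auto_degree_0[OF \<Gamma> inv_lie_auto[OF \<Gamma>(1) f]] by blast
  have L00: "L 0 0 \<in> W \<Gamma>" by (intro W_closed closed)
  \<comment> \<open>The factor \<open>d\<close> of the inverse automorphism turns out to be
    \<open>1 / c\<close>, so closure of \<open>\<Gamma>\<close> under \<open>d\<close> is closure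
    under division by \<open>c\<close>.\<close>
  have "f (?g (L 0 0)) = L 0 0"
    using L00 lie_autoD(1)[OF f] by (simp add: Bij_def bij_betw_def f_inv_into_f)
  then have "scale (1 / d * (1 / c)) (L 0 0) = scale 1 (L 0 0)"
    unfolding d(2) lie_autoD(5)[OF f L00] c(3) scale_simps .
  then have "1 / d * (1 / c) = 1" by (rule scale_L_cancel)
  then have "d = 1 / c" using c(1) d(1) by (simp add: field_simps)
  then have scaling: "c \<in> scalings \<Gamma>"
    using c(1,4) d(3) by (simp add: scalings_iff)
  obtain k where k: "\<And>a. a \<in> \<Gamma> \<Longrightarrow> f (L a 0) = scale (k a) (L (c * a) 0)"
    using c(2) by metis
  have knz: "k a \<noteq> 0" if "a \<in> \<Gamma>" for a
    using nz[OF that] k[OF that] by (auto simp: scale_simps)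
  have "f (L a 0) * f (L b 0) = f (L 0 0) * f (L (a + b) 0)" if ab: "a \<in> \<Gamma>" "b \<in> \<Gamma>" for a b
  proof (rule witt_subalgebra_mult[of \<Gamma> "\<lambda>a. f (L a 0)"])
    fix a b assume ab: "a \<in> \<Gamma>" "b \<in> \<Gamma>"
    show "bracket (f (L a 0)) (f (L b 0)) = scale (b - a) (f (L (a + b) 0))"
      using lie_autoD(6)[OF f W_closed(4)[OF ab(1)] W_closed(4)[OF ab(2)], of 0 0]
      by (simp add: bracket_L scale_simps lie_autoD(5)[OF f] W_closed ab closed)
  qed (use closed nz ab in auto)
  then have "scale (k a * k b) (L (c * (a + b)) 0) = scale (k (a + b) / c) (L (c * (a + b)) 0)"
    if "a \<in> \<Gamma>" "b \<in> \<Gamma>" for a b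
    using that unfolding c(3)
    by (simp add: k closed scale_mult L_mult scale_simps distrib_left mult.commute)
  then have k_mult: "k a * k b = k (a + b) / c" if "a \<in> \<Gamma>" "b \<in> \<Gamma>" for a b
    using that by (intro scale_L_cancel)
  \<comment> \<open>\<open>phi\<close> contributes a factor \<open>1 / c\<close> at
    \<open>L a 0\<close>, so the character has to be \<open>c * k a\<close>; it is multiplicative by
    \<open>k_mult\<close>.\<close>
  define p where "p = (\<lambda>a\<in>\<Gamma>. c * k a, c)"
  have p: "p \<in> carrier (semidirect \<Gamma>)"
    using scaling c(1) knz k_mult by (simp add: p_def semidirect_simps characters_iff closed field_simps)
  let ?q = "phi \<Gamma> (inv\<^bsub>semidirect \<Gamma>\<^esub> p)"
  have q: "?q \<in> lie_auto \<Gamma>"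
    using group.inv_closed[OF group_semidirect[OF \<Gamma>(1)] p] by (rule phi_lie_auto[OF \<Gamma>(1)])
  have phi_L0: "phi \<Gamma> p (L a 0) = f (L a 0)" if "a \<in> \<Gamma>" for a
    using that c(1) by (simp add: p_def phi_L k power_int_minus field_simps)
  \<comment> \<open>Composing \<open>f\<close> with the inverse of \<open>phi \<Gamma> p\<close>
    reduces the claim to maps that fix every \<open>L a 0\<close>.\<close>
  have "?q (f x) = x" if x: "x \<in> W \<Gamma>" for x
  proof (rule lie_hom_fixing_degree_0[of \<Gamma> "\<lambda>x. ?q (f x)"])
    show "?q (f (L 0 1)) \<noteq> 0"
      using lie_auto_eq_0[OF q] lie_auto_eq_0[OF f] lie_autoD(2)[OF f] L_nonzero W_closed(4)[OF closed(1)]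
      by metis
    show "?q (f (L a 0)) = L a 0" if "a \<in> \<Gamma>" for a
      using phi_inverse(2)[OF \<Gamma>(1) p W_closed(4)[OF that]] phi_L0[OF that] by metis
  qed (use x \<Gamma>(2) in \<open>simp_all add: closed lie_autoD[OF f] lie_autoD[OF q]\<close>)
  then have "phi \<Gamma> p x = f x" if "x \<in> W \<Gamma>" for x
    using phi_inverse(1)[OF \<Gamma>(1) p lie_autoD(2)[OF f that]] that by metis
  moreover have "phi \<Gamma> p \<in> extensional (W \<Gamma>)" "f \<in> extensional (W \<Gamma>)"
    using phi_lie_auto[OF \<Gamma>(1) p] f by (auto simp: lie_auto_def Bij_def)
  ultimately have "f = phi \<Gamma> p"
    by (intro extensionalityI) auto
  then show ?thesis using p by blast
qed

theorem theorem4p1: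
  fixes \<Gamma> :: "complex set"
  assumes "subgroup \<Gamma> complex_add" and "\<Gamma> \<noteq> {0}"
  shows "group (semidirect \<Gamma>) \<and> group (LieAutoGroup \<Gamma>) \<and>
         phi \<Gamma> \<in> iso (semidirect \<Gamma>) (LieAutoGroup \<Gamma>)"
proof (intro conjI)
  show "group (semidirect \<Gamma>)" by (rule group_semidirect[OF assms(1)])
  show "group (LieAutoGroup \<Gamma>)" by (rule group_LieAutoGroup[OF assms(1)])
  have carrier: "carrier (LieAutoGroup \<Gamma>) = lie_auto \<Gamma>" by (simp add: LieAutoGroup_def)
  have "phi \<Gamma> (p \<otimes>\<^bsub>semidirect \<Gamma>\<^esub> q) = phi \<Gamma> p \<otimes>\<^bsub>LieAutoGroup \<Gamma>\<^esub> phi \<Gamma> q"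
    if p: "p \<in> carrier (semidirect \<Gamma>)" and q: "q \<in> carrier (semidirect \<Gamma>)" for p q
  proof (rule extensionalityI)
    show "phi \<Gamma> (p \<otimes>\<^bsub>semidirect \<Gamma>\<^esub> q) \<in> extensional (W \<Gamma>)"
      by (simp add: phi_def split_def)
    show "phi \<Gamma> p \<otimes>\<^bsub>LieAutoGroup \<Gamma>\<^esub> phi \<Gamma> q \<in> extensional (W \<Gamma>)"
      by (simp add: mult_LieAutoGroup phi_lie_auto[OF assms(1)] p q)
    fix x assume "x \<in> W \<Gamma>"
    then show "phi \<Gamma> (p \<otimes>\<^bsub>semidirect \<Gamma>\<^esub> q) x = (phi \<Gamma> p \<otimes>\<^bsub>LieAutoGroup \<Gamma>\<^esub> phi \<Gamma> q) x"
      by (simp add: mult_LieAutoGroup phi_lie_auto[OF assms(1)] p q compose_eq phi_mult)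
  qed
  then have "phi \<Gamma> \<in> hom (semidirect \<Gamma>) (LieAutoGroup \<Gamma>)"
    by (auto simp: hom_def carrier phi_lie_auto[OF assms(1)])
  moreover have "bij_betw (phi \<Gamma>) (carrier (semidirect \<Gamma>)) (carrier (LieAutoGroup \<Gamma>))"
    using phi_inj[OF assms] phi_lie_auto[OF assms(1)] lie_auto_is_phi[OF assms]
    by (auto simp: bij_betw_def carrier)
  ultimately show "phi \<Gamma> \<in> iso (semidirect \<Gamma>) (LieAutoGroup \<Gamma>)"
    by (simp add: iso_def)
qed

end
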